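(* The assignments $$\varphi_0:\ \widetilde X(\mathfrak{sp}_2,\mathfrak{sp}_2)^{tw}\to\widetilde{\mathcal B}(2,0),\quad \widetilde S(u)\mapsto \widetilde B^\circ(u/2),\qquad\qquad \varphi_1:\ \widetilde X(\mathfrak{sp}_2,\mathfrak{gl}_1)^{tw}\to\widetilde{\mathcal B}(2,1),\quad \widetilde S(u)\mapsto -\widetilde B^\circ(u/2),$$ and $$\varphi_0':\ \widetilde X(\mathfrak{sp}_2,\mathfrak{sp}_2)^{tw}\to\widetilde Y^-(2),\quad \widetilde S(u)\mapsto \widetilde S^\circ(u/2-1/2),\qquad \varphi_1':\ \widetilde X(\mathfrak{sp}_2,\mathfrak{gl}_1)^{tw}\to\widetilde Y^+(2),\quad \widetilde S(u)\mapsto \widetilde S^\circ(u/2-1/2)\,K,$$ define algebra isomorphisms.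
   Context: All algebras are unital associative over $\mathbb C$. Rows and columns of $2\times2$ matrices are indexed by $\{-1,1\}$ (in this order); $E_{ij}$ are the elementary matrices and $K=E_{11}-E_{-1,-1}$. Let $P=\sum_{i,j}E_{ij}\otimes E_{ji}$. Transpositions: $(E_{ij})^{t_+}=E_{-j,-i}$ and $(E_{ij})^{t_-}=\mathrm{sign}(i)\,\mathrm{sign}(j)\,E_{-j,-i}$. Let $Q^\pm$ be the partial transpose of $P$ under $t_\pm$ in either tensor factor. Put $R^\circ(u)=I-\frac{P}{u}$, $R^\circ(u)^{t_\pm}=I-\frac{Q^\pm}{u}$, and, for $\mathfrak{sp}_2$ (where $\kappa=2$), $R(u)=I-\frac{P}{u}+\frac{Q^-}{u-2}$. Subscripts $1,2$ on a matrix indicate the copy of $\mathrm{End}(\mathbb C^2)$ in the tensor square in which it acts. Each algebra below is generated by the coefficients $x_{ij}^{(r)}$ ($i,j\in\{-1,1\}$, $r\ge0$) of a generating matrix $X(u)=\sum_{i,j}\sum_{r\ge0}E_{ij}\otimes x_{ij}^{(r)}u^{-r}$ with prescribed constant term $\sum_{i,j} E_{ij}x_{ij}^{(0)}$, subject only to the stated matrix relation: - $\widetilde X(\mathfrak{sp}_2,\mathfrak{sp}_2)^{tw}$: generating matrix $\widetilde S(u)$ with constant term $I$; $\widetilde X(\mathfrak{sp}_2,\mathfrak{gl}_1)^{tw}$: generating matrix $\widetilde S(u)$ with constant term $K$; relation in both cases $R(u-v)\widetilde S_1(u)R(u+v)\widetilde S_2(v)=\widetilde S_2(v)R(u+v)\widetilde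 S_1(u)R(u-v)$. - $\widetilde{\mathcal B}(2,q)$, $q\in\{0,1\}$: generating matrix $\widetilde B^\circ(u)$ with constant term $E_{-1,-1}+(-1)^qE_{11}$; relation $R^\circ(u-v)\widetilde B^\circ_1(u)R^\circ(u+v)\widetilde B^\circ_2(v)=\widetilde B^\circ_2(v)R^\circ(u+v)\widetilde B^\circ_1(u)R^\circ(u-v)$. - $\widetilde Y^\pm(2)$: generating matrix $\widetilde S^\circ(u)$ with constant term $I$; relation $R^\circ(u-v)\widetilde S^\circ_1(u)R^\circ(-u-v)^{t_\pm}\widetilde S^\circ_2(v)=\widetilde S^\circ_2(v)R^\circ(-u-v)^{t_\pm}\widetilde S^\circ_1(u)R^\circ(u-v)$. *)

theory Defs
  imports
    "HOL-Analysis.Finite_Cartesian_Product"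
    "HOL-Library.Poly_Mapping"
    "HOL-Computational_Algebra.Formal_Laurent_Series"
    "HOL-Algebra.QuotRing"
    "HOL-Algebra.Module"
begin

unbundle no m_inv_syntax

section \<open>Matrices indexed by $\{-1,1\}$\<close>

datatype idx = Neg | Pos

instance idx :: finite
proof
  have "(UNIV :: idx set) = {Neg, Pos}"
    using idx.exhaust by auto
  then show "finite (UNIV :: idx set)"
    by (metis finite.emptyI finite_insert)
qed

lemma UNIV_idx: "UNIV = {Neg, Pos}"
  using idx.exhaust by auto

instantiation idx :: uminus
begin

definition uminus_idx :: "idx \<Rightarrow> idx" where
  "- i = (case i of Neg \<Rightarrow> Pos | Pos \<Rightarrow> Neg)"

instance ..

end

definition sign :: "idx \<Rightarrow> 'a::ring_1" where
  "sign i = (case i of Neg \<Rightarrow> - 1 | Pos \<Rightarrow> 1)"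

type_synonym 'a mat2 = "'a^idx^idx"

text \<open>Elements of $\mathrm{End}(\mathbb C^2)\otimes\mathrm{End}(\mathbb C^2)\otimes A$.\<close>

type_synonym 'a mat4 = "'a^(idx \<times> idx)^(idx \<times> idx)"

definition matE :: "idx \<Rightarrow> idx \<Rightarrow> 'a::semiring_1 mat2" where
  "matE i j = (\<chi> a b. if a = i \<and> b = j then 1 else 0)"

definition matK :: "'a::ring_1 mat2" where
  "matK = matE Pos Pos - matE Neg Neg"

definition kron :: "'a::semiring_1 mat2 \<Rightarrow> 'a mat2 \<Rightarrow> 'a mat4"  (infixl \<open>\<otimes>\<^sub>k\<close> 70) where
  "M \<otimes>\<^sub>k N = (\<chi> p q. M $ fst p $ fst q * N $ snd p $ snd q)"

definition matP :: "'a::ring_1 mat4" where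
  "matP = (\<Sum>i\<in>UNIV. \<Sum>j\<in>UNIV. matE i j \<otimes>\<^sub>k matE j i)"

text \<open>Linear extensions of $E_{ij}\mapsto E_{-j,-i}$ and
  $E_{ij}\mapsto\mathrm{sign}(i)\,\mathrm{sign}(j)\,E_{-j,-i}$.\<close>

definition t_plus :: "'a::ring_1 mat2 \<Rightarrow> 'a mat2" where
  "t_plus M = (\<Sum>i\<in>UNIV. \<Sum>j\<in>UNIV. map_matrix (\<lambda>x. M $ i $ j * x) (matE (- j) (- i)))"

definition t_minus :: "'a::ring_1 mat2 \<Rightarrow> 'a mat2" where
  "t_minus M = (\<Sum>i\<in>UNIV. \<Sum>j\<in>UNIV.
     map_matrix (\<lambda>x. M $ i $ j * sign i * sign j * x) (matE (- j) (- i)))"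

definition partial_transpose1 :: "('a mat2 \<Rightarrow> 'a mat2) \<Rightarrow> 'a::ring_1 mat4 \<Rightarrow> 'a mat4" where
  "partial_transpose1 t M = (\<Sum>i\<in>UNIV. \<Sum>j\<in>UNIV. \<Sum>k\<in>UNIV. \<Sum>l\<in>UNIV.
     map_matrix (\<lambda>x. M $ (i, k) $ (j, l) * x) (t (matE i j) \<otimes>\<^sub>k matE k l))"

definition partial_transpose2 :: "('a mat2 \<Rightarrow> 'a mat2) \<Rightarrow> 'a::ring_1 mat4 \<Rightarrow> 'a mat4" where
  "partial_transpose2 t M = (\<Sum>i\<in>UNIV. \<Sum>j\<in>UNIV. \<Sum>k\<in>UNIV. \<Sum>l\<in>UNIV.
     map_matrix (\<lambda>x. M $ (i, k) $ (j, l) * x) (matE i j \<otimes>\<^sub>k t (matE k l)))"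

definition Q_plus :: "'a::ring_1 mat4" where
  "Q_plus = partial_transpose2 t_plus matP"

definition Q_minus :: "'a::ring_1 mat4" where
  "Q_minus = partial_transpose2 t_minus matP"

lemmas mat_entry_defs =
  matE_def kron_def matP_def t_plus_def t_minus_def partial_transpose1_def
  partial_transpose2_def uminus_idx_def sign_def UNIV_idx

lemma Q_plus_either: "Q_plus = partial_transpose1 t_plus matP"
  unfolding Q_plus_def vec_eq_iff
  by (auto simp: mat_entry_defs split: idx.splits)

lemma Q_minus_either: "Q_minus = partial_transpose1 t_minus matP"
  unfolding Q_minus_def vec_eq_iff
  by (auto simp: mat_entry_defs split: idx.splits)


section \<open>R-matrices\<close>

text \<open>Rational functions of $u,v$ are expanded in the iterated Laurent series field
  $\mathbb C((v^{-1}))((u^{-1}))$, that is, in the region $|u|>|v|$.  Since the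
  indeterminate of a Laurent series in the library has positive order, it plays the role
  of $u^{-1}$ (outer) or $v^{-1}$ (inner), and \<^const>\<open>fls_X_inv\<close> is $u$ or $v$.\<close>

type_synonym scal2 = "complex fls fls"

definition var_u :: scal2 where
  "var_u = fls_X_inv"

definition var_v :: scal2 where
  "var_v = fls_const fls_X_inv"

definition R_circ :: "scal2 \<Rightarrow> scal2 mat4" where
  "R_circ w = mat 1 - map_matrix (\<lambda>x. x / w) matP"

definition R_circ_t_plus :: "scal2 \<Rightarrow> scal2 mat4" where
  "R_circ_t_plus w = mat 1 - map_matrix (\<lambda>x. x / w) Q_plus"

definition R_circ_t_minus :: "scal2 \<Rightarrow> scal2 mat4" where
  "R_circ_t_minus w = mat 1 - map_matrix (\<lambda>x. x / w) Q_minus"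

definition R_sp2 :: "scal2 \<Rightarrow> scal2 mat4" where
  "R_sp2 w = mat 1 - map_matrix (\<lambda>x. x / w) matP + map_matrix (\<lambda>x. x / (w - 2)) Q_minus"


section \<open>The free algebra on the generators $x_{ij}^{(r)}$\<close>

text \<open>The free monoid, written additively so that finitely supported functions on it
  carry the convolution product of the monoid algebra.\<close>

datatype 'a word = Word (letters: "'a list")

instantiation word :: (type) monoid_add
begin

definition zero_word :: "'a word" where
  "0 = Word []"

definition plus_word :: "'a word \<Rightarrow> 'a word \<Rightarrow> 'a word" where
  "a + b = Word (letters a @ letters b)"

instance
  by standard (auto simp: zero_word_def plus_word_def)

end

type_synonym free = "(idx \<times> idx \<times> nat) word \<Rightarrow>\<^sub>0 complex"

definition scalar :: "complex \<Rightarrow> free" where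
  "scalar c = Poly_Mapping.single 0 c"

definition gen :: "idx \<Rightarrow> idx \<Rightarrow> nat \<Rightarrow> free" where
  "gen i j r = Poly_Mapping.single (Word [(i, j, r)]) 1"

definition free_algebra :: "(complex, free) module" where
  "free_algebra = \<lparr>carrier = UNIV, monoid.mult = (*), one = 1, zero = 0, add = (+),
                   smult = (\<lambda>c x. scalar c * x)\<rparr>"

lemma ring_free_algebra: "ring free_algebra"
proof (rule ringI)
  show "abelian_group free_algebra"
  proof (rule abelian_groupI)
    fix x assume "x \<in> carrier free_algebra"
    show "\<exists>y\<in>carrier free_algebra. y \<oplus>\<^bsub>free_algebra\<^esub> x = \<zero>\<^bsub>free_algebra\<^esub>"
      by (rule bexI[of _ "- x"]) (auto simp: free_algebra_def)
  qed (auto simp: free_algebra_def algebra_simps)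
  show "monoid free_algebra"
    by (rule monoidI) (auto simp: free_algebra_def algebra_simps)
qed (auto simp: free_algebra_def algebra_simps)

text \<open>The quotient by the two-sided ideal generated by \<open>S\<close>, with the induced
  scalar multiplication.\<close>

definition coset :: "free set \<Rightarrow> free \<Rightarrow> free set" where
  "coset S x = Idl\<^bsub>free_algebra\<^esub> S +>\<^bsub>free_algebra\<^esub> x"

definition presented_algebra :: "free set \<Rightarrow> (complex, free set) module" where
  "presented_algebra S = ring.extend (free_algebra Quot (Idl\<^bsub>free_algebra\<^esub> S))
     (module.fields (\<lambda>c X. \<Union>x\<in>X. coset S (c \<odot>\<^bsub>free_algebra\<^esub> x)))"

definition algebra_iso ::
  "(complex, 'a) module \<Rightarrow> (complex, 'b) module \<Rightarrow> ('a \<Rightarrow> 'b) \<Rightarrow> bool" where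
  "algebra_iso A B f \<longleftrightarrow> f \<in> ring_iso A B \<and>
     (\<forall>c. \<forall>x\<in>carrier A. f (c \<odot>\<^bsub>A\<^esub> x) = c \<odot>\<^bsub>B\<^esub> f x)"


section \<open>Generating matrices and defining relations\<close>

text \<open>A power series stands for a series in $u^{-1}$.\<close>

definition gen_matrix :: "free fps mat2" where
  "gen_matrix = (\<chi> i j. Abs_fps (\<lambda>r. gen i j r))"

text \<open>Coefficientwise application of \<open>f\<close>; meaningful when \<open>f 0 = 0\<close>.\<close>

definition map_fls :: "('a::zero \<Rightarrow> 'b::zero) \<Rightarrow> 'a fls \<Rightarrow> 'b fls" where
  "map_fls f F = Abs_fls (\<lambda>n. f (fls_nth F n))"

lemma map_fls_nth:
  assumes "f 0 = 0"
  shows "fls_nth (map_fls f F) n = f (fls_nth F n)"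
  unfolding map_fls_def
  by (rule nth_Abs_fls_lower_bound[of "fls_subdegree F"]) (use assms in auto)

definition scal2_matrix :: "scal2 mat4 \<Rightarrow> free fls fls mat4" where
  "scal2_matrix = map_matrix (map_fls (map_fls scalar))"

definition series_u :: "free fps \<Rightarrow> free fls fls" where
  "series_u f = fps_to_fls (Abs_fps (\<lambda>r. fls_const (fps_nth f r)))"

definition series_v :: "free fps \<Rightarrow> free fls fls" where
  "series_v f = fls_const (fps_to_fls f)"

definition X1_u :: "free fls fls mat4" where
  "X1_u = map_matrix series_u gen_matrix \<otimes>\<^sub>k mat 1"

definition X2_v :: "free fls fls mat4" where
  "X2_v = mat 1 \<otimes>\<^sub>k map_matrix series_v gen_matrix"

text \<open>The relators stating $X(u)$ has constant term \<open>C\<close> and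
  $A\,X_1(u)\,B\,X_2(v)=X_2(v)\,B\,X_1(u)\,A$.\<close>

definition relators :: "complex mat2 \<Rightarrow> scal2 mat4 \<Rightarrow> scal2 mat4 \<Rightarrow> free set" where
  "relators C A B =
     {gen i j 0 - scalar (C $ i $ j) | i j. True} \<union>
     {fls_nth (fls_nth
        ((scal2_matrix A ** X1_u ** scal2_matrix B ** X2_v
          - X2_v ** scal2_matrix B ** X1_u ** scal2_matrix A) $ p $ q) m) n | p q m n. True}"

definition rel_X_sp2_sp2 :: "free set" where
  "rel_X_sp2_sp2 = relators (mat 1) (R_sp2 (var_u - var_v)) (R_sp2 (var_u + var_v))"

definition rel_X_sp2_gl1 :: "free set" where
  "rel_X_sp2_gl1 = relators matK (R_sp2 (var_u - var_v)) (R_sp2 (var_u + var_v))"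

definition rel_B2 :: "nat \<Rightarrow> free set" where
  "rel_B2 q = relators (matE Neg Neg + map_matrix (\<lambda>x. (- 1) ^ q * x) (matE Pos Pos))
     (R_circ (var_u - var_v)) (R_circ (var_u + var_v))"

definition rel_Y2_plus :: "free set" where
  "rel_Y2_plus = relators (mat 1) (R_circ (var_u - var_v)) (R_circ_t_plus (- var_u - var_v))"

definition rel_Y2_minus :: "free set" where
  "rel_Y2_minus = relators (mat 1) (R_circ (var_u - var_v)) (R_circ_t_minus (- var_u - var_v))"


section \<open>Assignments of generating matrices\<close>

text \<open>$X(w)=\sum_r x^{(r)}w^{-r}$ re-expanded in $u^{-1}$: composition with the power series
  $w^{-1}$.  This requires \<open>w\<close> to have degree one in $u$, so that $w^{-1}$ has no
  constant term.\<close>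

definition gen_matrix_at :: "complex fls \<Rightarrow> free fps mat2" where
  "gen_matrix_at w =
     map_matrix (\<lambda>f. fps_compose f (fls_regpart (map_fls scalar (inverse w)))) gen_matrix"

text \<open>The assignment $X(u)\mapsto M(u)$, where the entries of \<open>M\<close> are representatives of
  series over the algebra presented by \<open>T\<close>.\<close>

definition defines_algebra_iso :: "free set \<Rightarrow> free set \<Rightarrow> free fps mat2 \<Rightarrow> bool" where
  "defines_algebra_iso S T M \<longleftrightarrow>
     (\<exists>f. algebra_iso (presented_algebra S) (presented_algebra T) f \<and>
        (\<forall>i j r. f (coset S (gen i j r)) = coset T (fps_nth (M $ i $ j) r)))"

end

theory Submission
  imports Defs
begin

text \<open>Since $P+Q^-=I$ on $\mathbb C^2\otimes\mathbb C^2$, one has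
  $R(u)=\frac{u-1}{u-2}\,R^\circ(u/2)=\frac{u-1}{u}\,R^\circ(1-u/2)^{t_-}$, and conjugation by
  $K$ in one tensor factor exchanges $Q^+$ and $Q^-$. Hence the assignment
  $X(u)\mapsto X(w(u))\,E$ with $w$ affine and $E\in\{1,-1,K\}$ turns one defining relation, up
  to invertible factors, into the other one with $u,v$ replaced by $w(u),w(v)$. This substitution
  is triangular on the coefficients of a series, so it neither enlarges nor shrinks the two-sided
  ideal that they generate, and the automorphism of the free algebra given by the assignment
  carries one ideal of relations onto the other.\<close>

text \<open>A relator is one coefficient in an expansion for |u| > |v|, and a change of variables
  mixes these coefficients, so the two sets of relators cannot be matched element by element. What
  is compared is which two-sided ideals contain them. Two actions on series over the free algebra
  are played against each other: one maps the generators and fixes scalar series, the other changes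
  u and v and fixes the generators. On X they agree up to the factor E; on the R-matrices they
  differ, which is what trades R for its counterpart of the target. With w(u) = (u - c)/2 one has
  w(u) - w(v) = (u - v)/2 for every c, so R(u - v) is always used in its form with P. In contrast
  w(u) + w(v) = (u + v)/2 - c. The target B needs (u + v)/2, hence c = 0; the target Y needs -w(u) -
  w(v) = 1 - (u + v)/2, hence c = 1, which is the shift by 1/2. The choice of E is governed by the
  constant terms, and E squares to 1 in every case.\<close>

no_notation fps_nth (infixl \<open>$\<close> 75)

section \<open>Ring homomorphisms, matrices and the free algebra\<close>

text \<open>The scalar embeddings, the changes of variable and the coefficientwise action of the
  substitution endomorphism are all of this kind, so one set of rules moves matrix identities
  through each of them.\<close>

definition unital_hom :: "('a::ring_1 \<Rightarrow> 'b::ring_1) \<Rightarrow> bool" where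
  "unital_hom f \<longleftrightarrow> (\<forall>x y. f (x + y) = f x + f y) \<and> (\<forall>x y. f (x * y) = f x * f y) \<and> f 1 = 1"

lemma unital_homI:
  "(\<And>x y. f (x + y) = f x + f y) \<Longrightarrow> (\<And>x y. f (x * y) = f x * f y) \<Longrightarrow> f 1 = 1 \<Longrightarrow> unital_hom f"
  by (simp add: unital_hom_def)

lemma
  assumes "unital_hom f"
  shows unital_hom_add: "f (x + y) = f x + f y"
    and unital_hom_mult: "f (x * y) = f x * f y"
    and unital_hom_one: "f 1 = 1"
    and unital_hom_zero: "f 0 = 0"
    and unital_hom_uminus: "f (- x) = - f x"
    and unital_hom_diff: "f (x - y) = f x - f y"
proof -
  show add: "f (x + y) = f x + f y" for x y using assms by (simp add: unital_hom_def)
  show "f (x * y) = f x * f y" "f 1 = 1" using assms by (simp_all add: unital_hom_def)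
  show zero: "f 0 = 0" using add[of 0 0] by simp
  show minus: "f (- x) = - f x" for x
    using add[of x "- x"] by (simp add: zero eq_neg_iff_add_eq_0 add.commute)
  show "f (x - y) = f x - f y" using add[of x "- y"] by (simp add: minus)
qed

lemmas unital_hom_simps =
  unital_hom_add unital_hom_mult unital_hom_one unital_hom_zero unital_hom_uminus unital_hom_diff

lemma unital_hom_sum: "unital_hom f \<Longrightarrow> f (sum g A) = (\<Sum>x\<in>A. f (g x))"
  by (induction A rule: infinite_finite_induct) (auto simp: unital_hom_simps)

lemma unital_hom_compose: "unital_hom f \<Longrightarrow> unital_hom g \<Longrightarrow> unital_hom (\<lambda>x. f (g x))"
  by (simp add: unital_hom_def)

text \<open>Any lower bounds for the two orders may delimit the sum. A coefficientwise image can
  have larger order than the original series; the range of the original is then kept and the extra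
  terms are zero.\<close>

lemma fls_times_nth_bounds:
  fixes F G :: "'a::ring_1 fls"
  assumes "\<And>n. n < N \<Longrightarrow> fls_nth F n = 0" "\<And>n. n < M \<Longrightarrow> fls_nth G n = 0"
  shows "fls_nth (F * G) k = (\<Sum>n=N..k - M. fls_nth F n * fls_nth G (k - n))"
proof (cases "F = 0 \<or> G = 0")
  case False
  then have le: "N \<le> fls_subdegree F" "M \<le> fls_subdegree G"
    using assms by (auto intro: fls_subdegree_geI)
  have "fls_nth F n * fls_nth G (k - n) = 0"
    if "n \<notin> {fls_subdegree F..k - fls_subdegree G}" for n
    using that by (cases "n < fls_subdegree F") auto
  with le show ?thesis
    unfolding fls_times_nth(2) by (intro sum.mono_neutral_left) auto
qed auto

lemma unital_hom_map_fls:
  assumes f: "unital_hom f"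
  shows "unital_hom (map_fls f)"
proof -
  have nth: "fls_nth (map_fls f F) n = f (fls_nth F n)" for F n
    by (rule map_fls_nth) (simp add: unital_hom_zero[OF f])
  show ?thesis
  proof (rule unital_homI; rule fls_eqI)
    fix F G n
    show "fls_nth (map_fls f (F + G)) n = fls_nth (map_fls f F + map_fls f G) n"
      by (simp add: nth unital_hom_simps[OF f])
    have "fls_nth (map_fls f F * map_fls f G) n =
        (\<Sum>m=fls_subdegree F..n - fls_subdegree G.
          fls_nth (map_fls f F) m * fls_nth (map_fls f G) (n - m))"
      by (rule fls_times_nth_bounds) (simp_all add: nth unital_hom_zero[OF f])
    then show "fls_nth (map_fls f (F * G)) n = fls_nth (map_fls f F * map_fls f G) n"
      unfolding nth fls_times_nth(2) unital_hom_sum[OF f] by (simp add: unital_hom_mult[OF f])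
  qed (simp add: nth unital_hom_simps[OF f])
qed

section \<open>Matrices and Kronecker products over noncommutative rings\<close>

lemma map_matrix_mult:
  assumes "unital_hom f"
  shows "map_matrix f (A ** B) = map_matrix f A ** map_matrix f B"
  by (simp add: vec_eq_iff matrix_matrix_mult_def unital_hom_sum[OF assms] unital_hom_mult[OF assms])

lemma map_matrix_diff:
  assumes "unital_hom f"
  shows "map_matrix f (A - B) = map_matrix f A - map_matrix f B"
  by (simp add: vec_eq_iff unital_hom_diff[OF assms])

lemma map_matrix_mat1:
  assumes "unital_hom f"
  shows "map_matrix f (mat 1) = mat 1"
  by (simp add: vec_eq_iff mat_def unital_hom_simps[OF assms])

lemma map_matrix_kron:
  assumes "unital_hom f"
  shows "map_matrix f (A \<otimes>\<^sub>k B) = map_matrix f A \<otimes>\<^sub>k map_matrix f B"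
  by (simp add: vec_eq_iff kron_def unital_hom_simps[OF assms])

text \<open>Entries need not commute. In each entry of the product, only an entry of
  \<open>B\<close> and an entry of \<open>C\<close> have to be exchanged.\<close>

lemma kron_mult:
  assumes "\<And>i j k l. B $ i $ j * C $ k $ l = C $ k $ l * B $ i $ j"
  shows "(A \<otimes>\<^sub>k B) ** (C \<otimes>\<^sub>k D) = (A ** C) \<otimes>\<^sub>k (B ** D)"
proof -
  have "(\<Sum>r\<in>UNIV. A $ fst p $ fst r * B $ snd p $ snd r * (C $ fst r $ fst q * D $ snd r $ snd q)) =
    (\<Sum>i\<in>UNIV. A $ fst p $ i * C $ i $ fst q) * (\<Sum>j\<in>UNIV. B $ snd p $ j * D $ j $ snd q)"
    for p q
    unfolding sum_product UNIV_Times_UNIV[symmetric] sum.cartesian_product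
  proof (intro sum.cong refl, clarify)
    fix i j
    have "A $ fst p $ i * B $ snd p $ j * (C $ i $ fst q * D $ j $ snd q) =
        A $ fst p $ i * (B $ snd p $ j * C $ i $ fst q) * D $ j $ snd q"
      by (simp only: mult.assoc)
    then show "A $ fst p $ fst (i, j) * B $ snd p $ snd (i, j) * (C $ fst (i, j) $ fst q * D $ snd (i, j) $ snd q) =
        A $ fst p $ i * C $ i $ fst q * (B $ snd p $ j * D $ j $ snd q)"
      by (simp add: assms) (simp only: mult.assoc)
  qed
  then show ?thesis
    by (simp add: vec_eq_iff kron_def matrix_matrix_mult_def)
qed

lemma mat1_entry_commutes: "mat 1 $ i $ j * (x::'a::semiring_1) = x * mat 1 $ i $ j"
  by (simp add: mat_def)

lemma kron_mat1_right_mult: "(A \<otimes>\<^sub>k mat 1) ** (C \<otimes>\<^sub>k mat 1) = (A ** C) \<otimes>\<^sub>k mat 1"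
  by (subst kron_mult[OF mat1_entry_commutes]) simp

lemma kron_mat1_left_mult: "(mat 1 \<otimes>\<^sub>k B) ** (mat 1 \<otimes>\<^sub>k D) = mat 1 \<otimes>\<^sub>k (B ** D)"
  by (subst kron_mult[OF mat1_entry_commutes[symmetric]]) simp

lemma kron_mat1: "mat 1 \<otimes>\<^sub>k mat 1 = mat 1"
  by (auto simp add: vec_eq_iff kron_def mat_def)

text \<open>Applied with at least one scalar matrix, to move a constant matrix in one tensor factor
  past a generating matrix in the other. The generating matrices X_1(u) and X_2(v) do not commute
  with each other in this way.\<close>

lemma kron_mat1_commute:
  assumes "\<And>i j k l. A $ i $ j * B $ k $ l = B $ k $ l * A $ i $ j"
  shows "(A \<otimes>\<^sub>k mat 1) ** (mat 1 \<otimes>\<^sub>k B) = (mat 1 \<otimes>\<^sub>k B) ** (A \<otimes>\<^sub>k mat 1)"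
  unfolding kron_mult[OF mat1_entry_commutes] kron_mult[OF assms[symmetric]] by simp

section \<open>Universal property of the free algebra\<close>

lemma poly_mapping_induct [case_names zero single add]:
  fixes f :: "'a \<Rightarrow>\<^sub>0 'b::comm_monoid_add"
  assumes "P 0" "\<And>k v. P (Poly_Mapping.single k v)" "\<And>f g. P f \<Longrightarrow> P g \<Longrightarrow> P (f + g)"
  shows "P f"
proof -
  have "P (\<Sum>k\<in>K. Poly_Mapping.single k (Poly_Mapping.lookup f k))" if "finite K" for K
    using that by (induction K) (auto intro: assms)
  moreover have "(\<Sum>k\<in>Poly_Mapping.keys f. Poly_Mapping.single k (Poly_Mapping.lookup f k)) = f"
    by (intro poly_mapping_eqI) 
      (auto simp: lookup_sum lookup_single when_def in_keys_iff if_distrib sum.delta cong: if_cong)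
  ultimately show ?thesis by (metis finite_keys)
qed

lemma unital_hom_scalar: "unital_hom scalar"
  by (rule unital_homI) (simp_all add: scalar_def single_add mult_single)

lemma scalar_central: "scalar c * x = x * scalar c"
  by (induction x rule: poly_mapping_induct)
    (simp_all add: scalar_def mult_single algebra_simps)

text \<open>The endomorphism extending \<phi> that the universal property provides. The sum runs
  over the support of \<open>x\<close>; \<open>free_lift_superset\<close> brings two elements to a
  common support so that additivity can be checked.\<close>

definition free_lift :: "(idx \<times> idx \<times> nat \<Rightarrow> free) \<Rightarrow> free \<Rightarrow> free" where
  "free_lift \<phi> x = (\<Sum>w\<in>Poly_Mapping.keys x.
     scalar (Poly_Mapping.lookup x w) * prod_list (map \<phi> (letters w)))"

lemma free_lift_superset:
  assumes "finite K" "Poly_Mapping.keys x \<subseteq> K"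
  shows "free_lift \<phi> x =
    (\<Sum>w\<in>K. scalar (Poly_Mapping.lookup x w) * prod_list (map \<phi> (letters w)))"
  unfolding free_lift_def using assms
  by (intro sum.mono_neutral_left)
    (auto simp: in_keys_iff unital_hom_zero[OF unital_hom_scalar])

lemma free_lift_add: "free_lift \<phi> (x + y) = free_lift \<phi> x + free_lift \<phi> y"
proof -
  let ?K = "Poly_Mapping.keys x \<union> Poly_Mapping.keys y"
  have "Poly_Mapping.keys (x + y) \<subseteq> ?K" by (rule Poly_Mapping.keys_add)
  then show ?thesis
    by (simp add: free_lift_superset[of ?K] lookup_add unital_hom_add[OF unital_hom_scalar]
        distrib_right sum.distrib)
qed

lemma free_lift_single:
  "free_lift \<phi> (Poly_Mapping.single w c) = scalar c * prod_list (map \<phi> (letters w))"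
  by (subst free_lift_superset[of "{w}"]) auto

text \<open>Additivity reduces the claim to two monomials. There words concatenate, and centrality
  moves the second coefficient past the image of the first word.\<close>

lemma free_lift_mult: "free_lift \<phi> (x * y) = free_lift \<phi> x * free_lift \<phi> y"
proof (induction x rule: poly_mapping_induct)
  case (single w c)
  show ?case
  proof (induction y rule: poly_mapping_induct)
    case (single w' c')
    have "scalar c * scalar c' * (a * b) = scalar c * a * (scalar c' * b)" for a b
    proof -
      have "scalar c * scalar c' * (a * b) = scalar c * (scalar c' * a) * b"
        by (simp only: mult.assoc)
      then show ?thesis
        by (simp only: scalar_central[of c' a]) (simp only: mult.assoc)
    qed
    then show ?case
      by (simp add: mult_single free_lift_single plus_word_def unital_hom_mult[OF unital_hom_scalar])
  qed (simp_all add: free_lift_add distrib_left, simp add: free_lift_def)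
qed (simp_all add: free_lift_add distrib_right, simp add: free_lift_def)

lemma free_lift_scalar [simp]: "free_lift \<phi> (scalar c) = scalar c"
  by (simp add: scalar_def free_lift_single zero_word_def)

lemma free_lift_gen [simp]: "free_lift \<phi> (gen i j r) = \<phi> (i, j, r)"
  by (simp add: gen_def free_lift_single unital_hom_one[OF unital_hom_scalar])

lemma unital_hom_free_lift: "unital_hom (free_lift \<phi>)"
  using free_lift_scalar[of \<phi> 1]
  by (intro unital_homI) (simp_all add: free_lift_add free_lift_mult unital_hom_one[OF unital_hom_scalar])

lemma prod_list_gen:
  "prod_list (map (\<lambda>(i, j, r). gen i j r) l) = Poly_Mapping.single (Word l) 1"
  by (induction l) (auto simp: gen_def mult_single plus_word_def simp flip: zero_word_def)

text \<open>Uniqueness half of the universal property, used to see that two substitution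
  endomorphisms undo each other.\<close>

lemma free_lift_identity:
  assumes "unital_hom f" "\<And>c. f (scalar c) = scalar c" "\<And>i j r. f (gen i j r) = gen i j r"
  shows "f x = x"
proof (induction x rule: poly_mapping_induct)
  case (single w c)
  have "f (prod_list (map (\<lambda>(i, j, r). gen i j r) l)) = prod_list (map (\<lambda>(i, j, r). gen i j r) l)" for l
    by (induction l) (auto simp: unital_hom_simps[OF assms(1)] assms(3))
  from this[of "letters w"] have "f (Poly_Mapping.single w 1) = Poly_Mapping.single w 1"
    by (simp add: prod_list_gen)
  moreover have "Poly_Mapping.single w c = scalar c * Poly_Mapping.single w 1"
    by (simp add: scalar_def mult_single)
  ultimately show ?case
    by (simp add: unital_hom_mult[OF assms(1)] assms(2))
qed (simp_all add: unital_hom_simps[OF assms(1)])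

section \<open>Substitution in Laurent series\<close>

text \<open>Substitution into a series with noncommuting coefficients is multiplicative because the
  substituted scalars can be moved past them; \<iota> embeds these scalars in the centre.\<close>

definition central_hom :: "('a::ring_1 \<Rightarrow> 'b::ring_1) \<Rightarrow> bool" where
  "central_hom \<iota> \<longleftrightarrow> unital_hom \<iota> \<and> (\<forall>c x. \<iota> c * x = x * \<iota> c)"

lemma central_hom_scalar: "central_hom scalar"
  by (simp add: central_hom_def unital_hom_scalar scalar_central)

lemma central_hom_fls_const:
  assumes "central_hom \<iota>"
  shows "central_hom (\<lambda>c. fls_const (\<iota> c))"
proof -
  have hom: "unital_hom \<iota>" and central: "\<iota> c * x = x * \<iota> c" for c x
    using assms by (auto simp: central_hom_def)
  have "unital_hom (\<lambda>c. fls_const (\<iota> c))"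
    by (rule unital_homI) (simp_all add: unital_hom_simps[OF hom] fls_plus_const)
  moreover have "fls_const (\<iota> c) * F = F * fls_const (\<iota> c)" for c F
    by (rule fls_eqI) (simp add: central)
  ultimately show ?thesis by (simp add: central_hom_def)
qed

lemma central_hom_map_fls:
  assumes "central_hom \<iota>"
  shows "central_hom (map_fls \<iota>)"
proof -
  have hom: "unital_hom \<iota>" and central: "\<iota> c * x = x * \<iota> c" for c x
    using assms by (auto simp: central_hom_def)
  have nth: "fls_nth (map_fls \<iota> F) n = \<iota> (fls_nth F n)" for F n
    by (rule map_fls_nth) (simp add: unital_hom_zero[OF hom])
  have "map_fls \<iota> C * F = F * map_fls \<iota> C" for C F
  proof (rule fls_eqI)
    fix k
    let ?N = "fls_subdegree C" and ?M = "fls_subdegree F"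
    have "fls_nth (map_fls \<iota> C * F) k =
        (\<Sum>n=?N..k - ?M. fls_nth (map_fls \<iota> C) n * fls_nth F (k - n))"
      by (rule fls_times_nth_bounds) (auto simp: nth unital_hom_zero[OF hom])
    also have "\<dots> = (\<Sum>n=?M..k - ?N. fls_nth F n * fls_nth (map_fls \<iota> C) (k - n))"
      by (rule sum.reindex_bij_witness[of _ "\<lambda>n. k - n" "\<lambda>n. k - n"]) (auto simp: nth central)
    also have "\<dots> = fls_nth (F * map_fls \<iota> C) k"
      by (rule fls_times_nth_bounds[symmetric]) (auto simp: nth unital_hom_zero[OF hom])
    finally show "fls_nth (map_fls \<iota> C * F) k = fls_nth (F * map_fls \<iota> C) k" .
  qed
  then show ?thesis
    by (simp add: central_hom_def unital_hom_map_fls[OF hom])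
qed

text \<open>Composition with h: the library variable stands for 1/u, so h = 1/w sends F(u) to
  F(w(u)). If h has order 1, then h^n starts at order n, and only the terms with n \<le> k reach the
  coefficient k.\<close>

definition fls_subst :: "(complex \<Rightarrow> 'a::ring_1) \<Rightarrow> complex fls \<Rightarrow> 'a fls \<Rightarrow> 'a fls" where
  "fls_subst \<iota> h F =
    Abs_fls (\<lambda>k. \<Sum>n=fls_subdegree F..k. fls_nth F n * \<iota> (fls_nth (h powi n) k))"

lemma fls_subst_nth:
  assumes "\<And>n. n < N \<Longrightarrow> fls_nth F n = 0"
  shows "fls_nth (fls_subst \<iota> h F) k = (\<Sum>n=N..k. fls_nth F n * \<iota> (fls_nth (h powi n) k))"
proof (cases "F = 0")
  case False
  then have le: "N \<le> fls_subdegree F" using assms by (auto intro: fls_subdegree_geI)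
  have "fls_nth (fls_subst \<iota> h F) k =
      (\<Sum>n=fls_subdegree F..k. fls_nth F n * \<iota> (fls_nth (h powi n) k))"
    unfolding fls_subst_def by (rule nth_Abs_fls_lower_bound[of "fls_subdegree F"]) auto
  also have "\<dots> = (\<Sum>n=N..k. fls_nth F n * \<iota> (fls_nth (h powi n) k))"
    using le by (intro sum.mono_neutral_left) auto
  finally show ?thesis .
next
  case True
  then show ?thesis unfolding fls_subst_def
    by (subst nth_Abs_fls_lower_bound[of 0]) auto
qed

lemma powi_nth_eq_0:
  fixes h :: "'a::field fls"
  shows "fls_subdegree h = 1 \<Longrightarrow> k < n \<Longrightarrow> fls_nth (h powi n) k = 0"
  by simp

lemma powi_nth_self_neq_0:
  fixes h :: "'a::field fls"
  assumes "fls_subdegree h = 1"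
  shows "fls_nth (h powi n) n \<noteq> 0"
proof -
  have "h powi n \<noteq> 0" using assms by auto
  from nth_fls_subdegree_nonzero[OF this] show ?thesis using assms by simp
qed

text \<open>The range of the sum is independent of n and m, which later allows the summations to be
  exchanged.\<close>

lemma powi_add_nth:
  fixes h :: "'a::field fls"
  assumes h: "fls_subdegree h = 1" and "N \<le> n" "M \<le> m"
  shows "fls_nth (h powi (n + m)) k =
    (\<Sum>i=N..k - M. fls_nth (h powi n) i * fls_nth (h powi m) (k - i))"
proof -
  have "h \<noteq> 0" using h by auto
  then have "h powi (n + m) = h powi n * h powi m" by (simp add: power_int_add)
  then show ?thesis
    using assms by (simp del: fls_times_nth) (rule fls_times_nth_bounds, auto)
qed

text \<open>Multiplicativity is a rearrangement of finite sums resting on h^(n+m) = h^n h^m. All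
  ranges are first brought to bounds depending only on N, M and k; the terms gained or lost vanish
  because \<open>a n i\<close> = 0 for i < n, or because F or G vanishes below its order.\<close>

lemma unital_hom_fls_subst:
  fixes \<iota> :: "complex \<Rightarrow> 'a::ring_1"
  assumes \<iota>: "central_hom \<iota>" and h: "fls_subdegree h = 1"
  shows "unital_hom (fls_subst \<iota> h)"
proof (rule unital_homI; rule fls_eqI)
  have hom: "unital_hom \<iota>" and central: "\<iota> c * x = x * \<iota> c" for c x
    using \<iota> by (auto simp: central_hom_def)
  fix F G :: "'a fls" and k :: int
  define N where "N = fls_subdegree F"
  define M where "M = fls_subdegree G"
  have F: "fls_nth F n = 0" if "n < N" for n using that by (simp add: N_def)
  have G: "fls_nth G n = 0" if "n < M" for n using that by (simp add: M_def)
  define a where "a n i = fls_nth (h powi n) i" for n i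
  have a: "a n i = 0" if "i < n" for n i
    using that h by (simp add: a_def)
  have sub: "fls_nth (fls_subst \<iota> h H) k = (\<Sum>n=L..k. fls_nth H n * \<iota> (a n k))"
    if "\<And>n. n < L \<Longrightarrow> fls_nth H n = 0" for H L k
    unfolding a_def using that by (rule fls_subst_nth)
  have sub':
    "fls_nth (fls_subst \<iota> h F) k = (\<Sum>n=N..k. fls_nth F n * \<iota> (a n k))"
    "fls_nth (fls_subst \<iota> h G) k = (\<Sum>n=M..k. fls_nth G n * \<iota> (a n k))" for k
    by (rule sub, erule F, rule sub, erule G)
  show "fls_nth (fls_subst \<iota> h (F + G)) k = fls_nth (fls_subst \<iota> h F + fls_subst \<iota> h G) k"
    using F G by (simp add: sub[of "min N M"] distrib_right sum.distrib)
  have "fls_nth (fls_subst \<iota> h (F * G)) k = (\<Sum>l=N+M..k. fls_nth (F * G) l * \<iota> (a l k))"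
    by (rule sub) (simp add: N_def M_def fls_times_nth_eq0)
  also have "\<dots> = (\<Sum>l=N+M..k. \<Sum>n=N..k-M. fls_nth F n * fls_nth G (l - n) * \<iota> (a l k))"
  proof (rule sum.cong[OF refl])
    fix l assume l: "l \<in> {N+M..k}"
    have "fls_nth (F * G) l = (\<Sum>n=N..l-M. fls_nth F n * fls_nth G (l - n))"
      by (rule fls_times_nth_bounds[OF F G])
    also have "\<dots> = (\<Sum>n=N..k-M. fls_nth F n * fls_nth G (l - n))"
      using l by (intro sum.mono_neutral_left) (auto simp: G)
    finally show "fls_nth (F * G) l * \<iota> (a l k) =
        (\<Sum>n=N..k-M. fls_nth F n * fls_nth G (l - n) * \<iota> (a l k))"
      by (simp add: sum_distrib_right)
  qed
  also have "\<dots> = (\<Sum>n=N..k-M. \<Sum>l=N+M..k. fls_nth F n * fls_nth G (l - n) * \<iota> (a l k))"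
    by (rule sum.swap)
  also have "\<dots> = (\<Sum>n=N..k-M. \<Sum>m=M..k-N. fls_nth F n * fls_nth G m * \<iota> (a (n + m) k))"
  proof (rule sum.cong[OF refl])
    fix n assume n: "n \<in> {N..k-M}"
    \<comment> \<open>The range is adjusted so that m = l - n runs over M..k - N. Dropped terms
      contain a coefficient of G below its order; added terms have l > k, where \<open>a l k\<close>
      vanishes.\<close>
    have "(\<Sum>l=N+M..k. fls_nth F n * fls_nth G (l - n) * \<iota> (a l k)) =
        (\<Sum>l=n+M..n+k-N. fls_nth F n * fls_nth G (l - n) * \<iota> (a l k))"
      using n by (intro sum.mono_neutral_cong) (auto simp: G a unital_hom_zero[OF hom])
    also have "\<dots> = (\<Sum>m=M..k-N. fls_nth F n * fls_nth G m * \<iota> (a (n + m) k))"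
      by (rule sum.reindex_bij_witness[of _ "\<lambda>m. n + m" "\<lambda>l. l - n"]) auto
    finally show "(\<Sum>l=N+M..k. fls_nth F n * fls_nth G (l - n) * \<iota> (a l k)) =
      (\<Sum>m=M..k-N. fls_nth F n * fls_nth G m * \<iota> (a (n + m) k))" .
  qed
  also have "\<dots> = (\<Sum>n=N..k-M. \<Sum>m=M..k-N. fls_nth F n * fls_nth G m *
      \<iota> (\<Sum>i=N..k-M. a n i * a m (k - i)))"
    by (intro sum.cong refl arg_cong2[of _ _ _ _ "(*)"] arg_cong[of _ _ \<iota>])
      (auto simp: a_def powi_add_nth[OF h])
  also have "\<dots> = (\<Sum>n=N..k-M. \<Sum>m=M..k-N. \<Sum>i=N..k-M.
      fls_nth F n * fls_nth G m * (\<iota> (a n i) * \<iota> (a m (k - i))))"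
    by (simp add: unital_hom_sum[OF hom] unital_hom_mult[OF hom] sum_distrib_left)
  also have "\<dots> = (\<Sum>n=N..k-M. \<Sum>i=N..k-M. \<Sum>m=M..k-N.
      fls_nth F n * fls_nth G m * (\<iota> (a n i) * \<iota> (a m (k - i))))"
    by (intro sum.cong refl sum.swap)
  also have "\<dots> = (\<Sum>i=N..k-M. \<Sum>n=N..k-M. \<Sum>m=M..k-N.
      fls_nth F n * fls_nth G m * (\<iota> (a n i) * \<iota> (a m (k - i))))"
    by (rule sum.swap)
  also have "\<dots> = (\<Sum>i=N..k-M. (\<Sum>n=N..k-M. fls_nth F n * \<iota> (a n i)) *
      (\<Sum>m=M..k-N. fls_nth G m * \<iota> (a m (k - i))))"
  proof -
    \<comment> \<open>Here centrality enters: a coefficient of a power of h passes a coefficient of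
      G.\<close>
    have "x * y * (\<iota> c * \<iota> d) = x * \<iota> c * (y * \<iota> d)" for x y c d
    proof -
      have "x * \<iota> c * (y * \<iota> d) = x * (\<iota> c * y) * \<iota> d" by (simp only: mult.assoc)
      then show ?thesis by (simp only: central[of c y]) (simp only: mult.assoc)
    qed
    then show ?thesis by (simp add: sum_product)
  qed
  also have "\<dots> = (\<Sum>i=N..k-M. fls_nth (fls_subst \<iota> h F) i * fls_nth (fls_subst \<iota> h G) (k - i))"
  proof (rule sum.cong[OF refl])
    fix i assume i: "i \<in> {N..k-M}"
    have "fls_nth (fls_subst \<iota> h F) i = (\<Sum>n=N..k-M. fls_nth F n * \<iota> (a n i))"
      using i unfolding sub'(1)
      by (intro sum.mono_neutral_left) (auto simp: a unital_hom_zero[OF hom])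
    moreover have "fls_nth (fls_subst \<iota> h G) (k - i) = (\<Sum>m=M..k-N. fls_nth G m * \<iota> (a m (k - i)))"
      using i unfolding sub'(2)
      by (intro sum.mono_neutral_left) (auto simp: a unital_hom_zero[OF hom])
    ultimately show "(\<Sum>n=N..k-M. fls_nth F n * \<iota> (a n i)) *
        (\<Sum>m=M..k-N. fls_nth G m * \<iota> (a m (k - i))) =
      fls_nth (fls_subst \<iota> h F) i * fls_nth (fls_subst \<iota> h G) (k - i)"
      by simp
  qed
  also have "\<dots> = fls_nth (fls_subst \<iota> h F * fls_subst \<iota> h G) k"
    by (rule fls_times_nth_bounds[symmetric]) (simp_all add: sub')
  finally show "fls_nth (fls_subst \<iota> h (F * G)) k =
      fls_nth (fls_subst \<iota> h F * fls_subst \<iota> h G) k" .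
  have "fls_nth (fls_subst \<iota> h 1) k = (\<Sum>n=0..k. if n = 0 then \<iota> (a 0 k) else 0)"
    unfolding sub[of 0 1, simplified] by (intro sum.cong refl) simp
  also have "\<dots> = (if k = 0 then 1 else 0)"
    by (auto simp: a_def unital_hom_simps[OF hom])
  finally show "fls_nth (fls_subst \<iota> h 1) k = fls_nth 1 k" by simp
qed

lemma fls_subst_const:
  assumes "central_hom \<iota>"
  shows "fls_subst \<iota> h (fls_const c) = fls_const c"
proof (rule fls_eqI)
  fix k
  have hom: "unital_hom \<iota>" using assms by (simp add: central_hom_def)
  have "fls_nth (fls_subst \<iota> h (fls_const c)) k =
      (\<Sum>n=0..k. if n = 0 then c * \<iota> (fls_nth (h powi 0) k) else 0)"
    unfolding fls_subst_nth[of 0 "fls_const c", simplified]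
    by (intro sum.cong refl) simp
  then show "fls_nth (fls_subst \<iota> h (fls_const c)) k = fls_nth (fls_const c) k"
    by (auto simp: unital_hom_simps[OF hom])
qed

text \<open>\<open>fls_X_inv\<close> is u and \<open>inverse h\<close> is w, so u is indeed sent to
  w(u).\<close>

lemma fls_subst_X_inv:
  assumes \<iota>: "central_hom \<iota>" and h: "fls_subdegree h = 1"
  shows "fls_subst \<iota> h fls_X_inv = map_fls \<iota> (inverse h)"
proof (rule fls_eqI)
  fix k
  have hom: "unital_hom \<iota>" using assms by (simp add: central_hom_def)
  have "fls_nth (fls_subst \<iota> h fls_X_inv) k =
      (\<Sum>n=-1..k. if n = -1 then \<iota> (fls_nth (inverse h) k) else 0)"
    unfolding fls_subst_nth[of "-1" fls_X_inv, simplified]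
    by (intro sum.cong refl) (simp add: unital_hom_one[OF hom])
  also have "\<dots> = \<iota> (fls_nth (inverse h) k)"
    using powi_nth_eq_0[OF h, of k "-1"] by (auto simp: unital_hom_zero[OF hom] power_int_def)
  finally show "fls_nth (fls_subst \<iota> h fls_X_inv) k = fls_nth (map_fls \<iota> (inverse h)) k"
    by (simp add: map_fls_nth unital_hom_zero[OF hom])
qed

section \<open>Two-sided ideals and coefficientwise membership\<close>

definition two_sided :: "'a::ring_1 set \<Rightarrow> bool" where
  "two_sided I \<longleftrightarrow> 0 \<in> I \<and> (\<forall>x\<in>I. \<forall>y\<in>I. x + y \<in> I) \<and> (\<forall>x\<in>I. \<forall>y. x * y \<in> I \<and> y * x \<in> I)"

lemma
  assumes "two_sided I"
  shows two_sided_zero: "0 \<in> I"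
    and two_sided_add: "x \<in> I \<Longrightarrow> y \<in> I \<Longrightarrow> x + y \<in> I"
    and two_sided_mult_right: "x \<in> I \<Longrightarrow> x * y \<in> I"
    and two_sided_mult_left: "x \<in> I \<Longrightarrow> y * x \<in> I"
    and two_sided_uminus: "x \<in> I \<Longrightarrow> - x \<in> I"
    and two_sided_diff: "x \<in> I \<Longrightarrow> y \<in> I \<Longrightarrow> x - y \<in> I"
proof -
  show add: "x \<in> I \<Longrightarrow> y \<in> I \<Longrightarrow> x + y \<in> I" for x y using assms by (simp add: two_sided_def)
  show "0 \<in> I" "x \<in> I \<Longrightarrow> x * y \<in> I" using assms by (simp_all add: two_sided_def)
  show left: "x \<in> I \<Longrightarrow> y * x \<in> I" for x y using assms by (simp add: two_sided_def)
  show minus: "x \<in> I \<Longrightarrow> - x \<in> I" for x using left[of x "- 1"] by simp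
  show "x \<in> I \<Longrightarrow> y \<in> I \<Longrightarrow> x - y \<in> I" using add[of x "- y"] minus[of y] by simp
qed

lemma two_sided_sum: "two_sided I \<Longrightarrow> (\<And>x. x \<in> A \<Longrightarrow> f x \<in> I) \<Longrightarrow> sum f A \<in> I"
  by (induction A rule: infinite_finite_induct) (auto simp: two_sided_zero two_sided_add)

text \<open>The kernel of coefficientwise reduction modulo I, rather than the ideal generated by I.
  Applied twice, it expresses that all coefficients in u and v lie in I.\<close>

definition fls_ideal :: "'a::ring_1 set \<Rightarrow> 'a fls set" where
  "fls_ideal I = {F. \<forall>n. fls_nth F n \<in> I}"

lemma two_sided_fls_ideal:
  assumes "two_sided I"
  shows "two_sided (fls_ideal I)"
  using assms unfolding two_sided_def[of "fls_ideal I"]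
  by (auto simp: fls_ideal_def fls_times_nth(2) two_sided_zero two_sided_add
      intro!: two_sided_sum intro: two_sided_mult_left two_sided_mult_right)

text \<open>The substitution matrix is triangular with invertible diagonal, so coefficients can be
  recovered one by one.\<close>

lemma fls_subst_mem_iff:
  assumes \<iota>: "central_hom \<iota>" and h: "fls_subdegree h = 1" and I: "two_sided I"
  shows "fls_subst \<iota> h F \<in> fls_ideal I \<longleftrightarrow> F \<in> fls_ideal I"
proof
  have hom: "unital_hom \<iota>" using \<iota> by (simp add: central_hom_def)
  define N where "N = fls_subdegree F"
  define a where "a n i = fls_nth (h powi n) i" for n i
  have sub: "fls_nth (fls_subst \<iota> h F) k = (\<Sum>n=N..k. fls_nth F n * \<iota> (a n k))" for k
    unfolding a_def by (rule fls_subst_nth) (simp add: N_def)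
  show "fls_subst \<iota> h F \<in> fls_ideal I" if "F \<in> fls_ideal I"
    using that unfolding fls_ideal_def mem_Collect_eq sub
    by (auto intro!: two_sided_sum[OF I] two_sided_mult_right[OF I])
  assume *: "fls_subst \<iota> h F \<in> fls_ideal I"
  have "fls_nth F (N + int k) \<in> I" for k
  proof (induction k rule: less_induct)
    case (less k)
    let ?n = "N + int k"
    have "fls_nth F n \<in> I" if "n \<in> {N..<?n}" for n
      using less.IH[of "nat (n - N)"] that by auto
    then have "(\<Sum>n\<in>{N..<?n}. fls_nth F n * \<iota> (a n ?n)) \<in> I"
      by (intro two_sided_sum[OF I] two_sided_mult_right[OF I])
    moreover have "{N..?n} = insert ?n {N..<?n}" by auto
    then have "fls_nth (fls_subst \<iota> h F) ?n =
        fls_nth F ?n * \<iota> (a ?n ?n) + (\<Sum>n\<in>{N..<?n}. fls_nth F n * \<iota> (a n ?n))"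
      unfolding sub by simp
    moreover have "fls_nth (fls_subst \<iota> h F) ?n \<in> I" using * by (simp add: fls_ideal_def)
    ultimately have "fls_nth F ?n * \<iota> (a ?n ?n) \<in> I"
      using two_sided_diff[OF I] by (metis add_diff_cancel_right')
    then have "fls_nth F ?n * \<iota> (a ?n ?n) * \<iota> (inverse (a ?n ?n)) \<in> I"
      by (rule two_sided_mult_right[OF I])
    moreover have "\<iota> (a ?n ?n) * \<iota> (inverse (a ?n ?n)) = 1"
      using powi_nth_self_neq_0[OF h]
      by (simp add: a_def unital_hom_one[OF hom] flip: unital_hom_mult[OF hom])
    ultimately show ?case by (simp add: mult.assoc)
  qed
  then have "fls_nth F n \<in> I" for n
    using two_sided_zero[OF I] N_def \<open>fls_nth F (N + int (nat (n - N))) \<in> I\<close>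
    by (cases "n < N") auto
  then show "F \<in> fls_ideal I" by (simp add: fls_ideal_def)
qed

section \<open>Composition of power series as a Laurent substitution\<close>

lemma fps_power_map_nth:
  assumes "unital_hom \<iota>"
  shows "fps_nth (Abs_fps (\<lambda>n. \<iota> (fps_nth g n)) ^ i) k = \<iota> (fps_nth (g ^ i) k)"
  by (induction i arbitrary: k)
    (auto simp: fps_mult_nth unital_hom_simps[OF assms] unital_hom_sum[OF assms])

text \<open>The composition occurring in \<open>gen_matrix_at w\<close>, with h =
  \<open>inverse w\<close>. For h of order 1 the regular part is the whole series.\<close>

definition fps_subst :: "(complex \<Rightarrow> 'a::ring_1) \<Rightarrow> complex fls \<Rightarrow> 'a fps \<Rightarrow> 'a fps" where
  "fps_subst \<iota> h f = fps_compose f (fls_regpart (map_fls \<iota> h))"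

lemma fps_subst_nth:
  assumes "unital_hom \<iota>" and h: "fls_subdegree h = 1"
  shows "fps_nth (fps_subst \<iota> h f) k = (\<Sum>i=0..k. fps_nth f i * \<iota> (fps_nth (fls_regpart h ^ i) k))"
proof -
  have "fls_regpart (map_fls \<iota> h) = Abs_fps (\<lambda>n. \<iota> (fps_nth (fls_regpart h) n))"
    by (rule fps_ext) (simp add: map_fls_nth unital_hom_zero[OF assms(1)])
  then show ?thesis
    by (simp only: fps_subst_def fps_compose_nth fps_power_map_nth[OF assms(1)])
qed

lemma powi_nth_regpart:
  fixes h :: "'a::field fls"
  assumes h: "fls_subdegree h = 1"
  shows "fls_nth (h powi int i) (int k) = fps_nth (fls_regpart h ^ i) k"
proof -
  have "h = fps_to_fls (fls_regpart h)" using h by simp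
  then have "h ^ i = fps_to_fls (fls_regpart h ^ i)" by (metis fps_to_fls_power)
  then show ?thesis by simp
qed

lemma sum_int_eq_sum_nat: "(\<Sum>n=0..int k. f n) = (\<Sum>i=0..k. f (int i))"
  by (rule sum.reindex_bij_witness[of _ int nat]) auto

text \<open>Links the composition of power series in the statement with the Laurent substitution,
  which applies also to u itself and hence to the R-matrices.\<close>

lemma fls_subst_fps:
  assumes \<iota>: "central_hom \<iota>" and h: "fls_subdegree h = 1"
  shows "fls_subst \<iota> h (fps_to_fls f) = fps_to_fls (fps_subst \<iota> h f)"
proof (rule fls_eqI)
  fix k
  have hom: "unital_hom \<iota>" using \<iota> by (simp add: central_hom_def)
  have *: "fls_nth (fls_subst \<iota> h (fps_to_fls f)) k =
      (\<Sum>n=0..k. fls_nth (fps_to_fls f) n * \<iota> (fls_nth (h powi n) k))"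
    by (rule fls_subst_nth) simp
  show "fls_nth (fls_subst \<iota> h (fps_to_fls f)) k = fls_nth (fps_to_fls (fps_subst \<iota> h f)) k"
  proof (cases "k < 0")
    case False
    then obtain m where "k = int m" using nonneg_int_cases[of k] by auto
    then show ?thesis
      unfolding * by (simp add: sum_int_eq_sum_nat fps_subst_nth[OF hom h] powi_nth_regpart[OF h]
          del: power_int_of_nat)
  qed (simp add: *)
qed

section \<open>Substitution in the generating matrices\<close>

definition embed_scal2 :: "scal2 \<Rightarrow> free fls fls" where
  "embed_scal2 = map_fls (map_fls scalar)"

definition const2 :: "'a::zero \<Rightarrow> 'a fls fls" where
  "const2 c = fls_const (fls_const c)"

lemma central_hom_embed_scal2: "central_hom embed_scal2"
  unfolding embed_scal2_def by (intro central_hom_map_fls central_hom_scalar)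

lemmas unital_hom_embed_scal2 = central_hom_embed_scal2[unfolded central_hom_def, THEN conjunct1]

lemma embed_scal2_nth: "fls_nth (fls_nth (embed_scal2 F) m) n = scalar (fls_nth (fls_nth F m) n)"
proof -
  have "map_fls scalar 0 = 0"
    by (rule fls_eqI) (simp add: map_fls_nth unital_hom_zero[OF unital_hom_scalar])
  then show ?thesis
    by (simp add: embed_scal2_def map_fls_nth unital_hom_zero[OF unital_hom_scalar])
qed

lemma fls_fls_eqI: "(\<And>m n. fls_nth (fls_nth F m) n = fls_nth (fls_nth G m) n) \<Longrightarrow> F = G"
  by (intro fls_eqI) auto

lemma embed_scal2_const2: "embed_scal2 (const2 c) = const2 (scalar c)"
  by (rule fls_fls_eqI) (auto simp: embed_scal2_nth const2_def unital_hom_zero[OF unital_hom_scalar])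

text \<open>Simultaneous substitution of w(u) for u and w(v) for v. The inner map treats v. The
  outer one treats u; its coefficients are series in v, so scalars enter it through
  \<open>fls_const\<close>.\<close>

definition double_subst :: "complex fls \<Rightarrow> free fls fls \<Rightarrow> free fls fls" where
  "double_subst h F = fls_subst (\<lambda>c. fls_const (scalar c)) h (map_fls (fls_subst scalar h) F)"

lemmas central_hom_const_scalar = central_hom_fls_const[OF central_hom_scalar]

lemma unital_hom_const_scalar: "unital_hom (\<lambda>c. fls_const (scalar c))"
  using central_hom_const_scalar by (simp add: central_hom_def)

lemma fls_const_sum: "fls_const (sum g A) = (\<Sum>x\<in>A. fls_const (g x :: 'a::ring_1))"
  by (induction A rule: infinite_finite_induct) (auto simp flip: fls_plus_const)

context
  fixes h :: "complex fls"
  assumes h: "fls_subdegree h = 1"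
begin

lemmas unital_hom_inner = unital_hom_fls_subst[OF central_hom_scalar h]

lemma map_inner_nth: "fls_nth (map_fls (fls_subst scalar h) F) n = fls_subst scalar h (fls_nth F n)"
  by (rule map_fls_nth) (rule unital_hom_zero[OF unital_hom_inner])

lemma unital_hom_double_subst: "unital_hom (double_subst h)"
  unfolding double_subst_def
  by (rule unital_hom_compose[OF unital_hom_fls_subst[OF central_hom_const_scalar h]
        unital_hom_map_fls[OF unital_hom_inner]])

text \<open>The one-variable criterion is used twice: for v with the ideal I, and for u with
  \<open>fls_ideal I\<close>, which is again two-sided.\<close>

lemma double_subst_mem_iff:
  assumes I: "two_sided I"
  shows "double_subst h F \<in> fls_ideal (fls_ideal I) \<longleftrightarrow> F \<in> fls_ideal (fls_ideal I)"
proof -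
  have "map_fls (fls_subst scalar h) F \<in> fls_ideal (fls_ideal I) \<longleftrightarrow> F \<in> fls_ideal (fls_ideal I)"
    using fls_subst_mem_iff[OF central_hom_scalar h I]
    by (simp add: fls_ideal_def[of "fls_ideal I"] map_inner_nth)
  then show ?thesis
    unfolding double_subst_def
    using fls_subst_mem_iff[OF central_hom_const_scalar h two_sided_fls_ideal[OF I]] by simp
qed

lemma double_subst_series_u: "double_subst h (series_u f) = series_u (fps_subst scalar h f)"
proof -
  have "map_fls (fls_subst scalar h) (series_u f) = series_u f"
    by (rule fls_eqI)
      (simp add: map_inner_nth series_u_def fls_subst_const[OF central_hom_scalar]
        unital_hom_zero[OF unital_hom_inner])
  moreover have "fps_subst (\<lambda>c. fls_const (scalar c)) h (Abs_fps (\<lambda>r. fls_const (fps_nth f r))) =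
    Abs_fps (\<lambda>r. fls_const (fps_nth (fps_subst scalar h f) r))"
  proof (rule fps_ext)
    show "fps_nth (fps_subst (\<lambda>c. fls_const (scalar c)) h (Abs_fps (\<lambda>r. fls_const (fps_nth f r)))) k =
      fps_nth (Abs_fps (\<lambda>r. fls_const (fps_nth (fps_subst scalar h f) r))) k" for k
      by (simp add: fps_subst_nth[OF _ h] unital_hom_scalar unital_hom_const_scalar fls_const_sum)
  qed
  ultimately show ?thesis
    unfolding double_subst_def series_u_def
    by (simp add: fls_subst_fps[OF central_hom_const_scalar h])
qed

lemma double_subst_fls_const: "double_subst h (fls_const F) = fls_const (fls_subst scalar h F)"
proof -
  have "map_fls (fls_subst scalar h) (fls_const F) = fls_const (fls_subst scalar h F)"
    by (rule fls_eqI) (simp add: map_inner_nth unital_hom_zero[OF unital_hom_inner])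
  then show ?thesis
    by (simp add: double_subst_def fls_subst_const[OF central_hom_const_scalar])
qed

lemma double_subst_series_v: "double_subst h (series_v f) = series_v (fps_subst scalar h f)"
  by (simp add: series_v_def double_subst_fls_const fls_subst_fps[OF central_hom_scalar h])

lemma double_subst_var_u: "double_subst h (embed_scal2 var_u) = embed_scal2 (map_fls fls_const (inverse h))"
proof -
  have "embed_scal2 var_u = fls_X_inv"
    by (rule fls_fls_eqI)
      (auto simp: embed_scal2_nth var_u_def unital_hom_simps[OF unital_hom_scalar])
  moreover have "map_fls (fls_subst scalar h) fls_X_inv = fls_X_inv"
    by (rule fls_eqI) (simp add: map_inner_nth unital_hom_simps[OF unital_hom_inner])
  ultimately have "double_subst h (embed_scal2 var_u) = map_fls (\<lambda>c. fls_const (scalar c)) (inverse h)"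
    by (simp add: double_subst_def fls_subst_X_inv[OF central_hom_const_scalar h])
  also have "\<dots> = embed_scal2 (map_fls fls_const (inverse h))"
    by (rule fls_fls_eqI) (auto simp: embed_scal2_nth map_fls_nth unital_hom_zero[OF unital_hom_scalar])
  finally show ?thesis .
qed

lemma double_subst_var_v: "double_subst h (embed_scal2 var_v) = embed_scal2 (fls_const (inverse h))"
proof -
  have "embed_scal2 var_v = fls_const fls_X_inv"
    by (rule fls_fls_eqI)
      (auto simp: embed_scal2_nth var_v_def unital_hom_simps[OF unital_hom_scalar])
  then have "double_subst h (embed_scal2 var_v) = fls_const (map_fls scalar (inverse h))"
    by (simp add: double_subst_fls_const fls_subst_X_inv[OF central_hom_scalar h])
  also have "\<dots> = embed_scal2 (fls_const (inverse h))"
    by (rule fls_fls_eqI) (auto simp: embed_scal2_nth map_fls_nth unital_hom_zero[OF unital_hom_scalar])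
  finally show ?thesis .
qed

text \<open>This handles the denominators of the R-matrices without inspecting their expansions: a
  homomorphism carries inverses to inverses. The target ring is noncommutative and has no division,
  so the image is identified by playing a left inverse against a right inverse.\<close>

lemma double_subst_inverse:
  assumes "double_subst h (embed_scal2 x) = embed_scal2 y" "x \<noteq> 0" "y \<noteq> 0"
  shows "double_subst h (embed_scal2 (inverse x)) = embed_scal2 (inverse y)"
proof -
  have "embed_scal2 (inverse y) * embed_scal2 y = 1"
    using assms(3) by (simp add: unital_hom_one[OF unital_hom_embed_scal2] flip: unital_hom_mult[OF unital_hom_embed_scal2])
  moreover have "embed_scal2 y * double_subst h (embed_scal2 (inverse x)) = 1"
    using assms(2) unfolding assms(1)[symmetric]
    by (simp add: unital_hom_one[OF unital_hom_embed_scal2] unital_hom_one[OF unital_hom_double_subst]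
      flip: unital_hom_mult[OF unital_hom_embed_scal2] unital_hom_mult[OF unital_hom_double_subst])
  ultimately show ?thesis
    using mult.assoc[of "embed_scal2 (inverse y)" "embed_scal2 y" "double_subst h (embed_scal2 (inverse x))"]
    by (simp only: mult_1_left mult_1_right)
qed

end

lemma unital_hom_series_u: "unital_hom series_u"
proof (rule unital_homI)
  fix f g :: "free fps"
  have "Abs_fps (\<lambda>r. fls_const (fps_nth (f * g) r)) =
      Abs_fps (\<lambda>r. fls_const (fps_nth f r)) * Abs_fps (\<lambda>r. fls_const (fps_nth g r))"
    by (rule fps_ext) (simp add: fps_mult_nth fls_const_sum)
  then show "series_u (f * g) = series_u f * series_u g"
    by (simp add: series_u_def fls_times_fps_to_fls)
  show "series_u (f + g) = series_u f + series_u g"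
    by (rule fls_eqI) (simp add: series_u_def fls_plus_const)
  show "series_u 1 = 1"
    by (rule fls_eqI) (simp add: series_u_def)
qed

lemma unital_hom_series_v: "unital_hom series_v"
  by (rule unital_homI) (simp_all add: series_v_def fls_plus_const fls_times_fps_to_fls)

lemma series_const:
  "series_u (fps_const c) = const2 c" "series_v (fps_const c) = const2 c"
  by (rule fls_fls_eqI; simp add: series_u_def series_v_def const2_def)+

text \<open>The matrix X(w(u)) E with h = 1/w. The four assignments have, in the order of the
  statement, E = 1, -1, 1, K.\<close>

definition subst_matrix :: "complex mat2 \<Rightarrow> complex fls \<Rightarrow> free fps mat2" where
  "subst_matrix E h = map_matrix (fps_subst scalar h) gen_matrix **
     map_matrix (\<lambda>c. fps_const (scalar c)) E"

definition subst_hom :: "complex mat2 \<Rightarrow> complex fls \<Rightarrow> free \<Rightarrow> free" where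
  "subst_hom E h = free_lift (\<lambda>(i, j, r). fps_nth (subst_matrix E h $ i $ j) r)"

lemma unital_hom_subst_hom: "unital_hom (subst_hom E h)"
  unfolding subst_hom_def by (rule unital_hom_free_lift)

lemma subst_hom_scalar [simp]: "subst_hom E h (scalar c) = scalar c"
  by (simp add: subst_hom_def)

lemma subst_hom_gen: "subst_hom E h (gen i j r) = fps_nth (subst_matrix E h $ i $ j) r"
  by (simp add: subst_hom_def)

text \<open>Acts on the generators and fixes scalar series, whereas \<open>double_subst\<close> acts
  on u and v and fixes the generators. \<open>subst_series_X1\<close> and
  \<open>subst_series_X2\<close> compare the two.\<close>

definition subst_series :: "complex mat2 \<Rightarrow> complex fls \<Rightarrow> free fls fls \<Rightarrow> free fls fls" where
  "subst_series E h = map_fls (map_fls (subst_hom E h))"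

lemma unital_hom_subst_series: "unital_hom (subst_series E h)"
  unfolding subst_series_def by (intro unital_hom_map_fls unital_hom_subst_hom)

lemma subst_series_nth:
  "fls_nth (fls_nth (subst_series E h F) m) n = subst_hom E h (fls_nth (fls_nth F m) n)"
  unfolding subst_series_def
  by (simp add: map_fls_nth unital_hom_zero[OF unital_hom_subst_hom]
      unital_hom_zero[OF unital_hom_map_fls[OF unital_hom_subst_hom]])

lemma subst_series_embed_scal2: "subst_series E h (embed_scal2 F) = embed_scal2 F"
  by (rule fls_fls_eqI) (simp add: subst_series_nth embed_scal2_nth)

definition embed_mat :: "complex mat2 \<Rightarrow> free fls fls mat2" where
  "embed_mat E = map_matrix (\<lambda>c. const2 (scalar c)) E"

lemma const2_scalar_central: "const2 (scalar c) * F = F * const2 (scalar c)"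
  using central_hom_embed_scal2 unfolding central_hom_def embed_scal2_const2[symmetric] by blast

lemma subst_series_gen_matrix:
  "map_matrix (subst_series E h) (map_matrix series_u gen_matrix) =
    map_matrix series_u (map_matrix (fps_subst scalar h) gen_matrix) ** embed_mat E"
  "map_matrix (subst_series E h) (map_matrix series_v gen_matrix) =
    map_matrix series_v (map_matrix (fps_subst scalar h) gen_matrix) ** embed_mat E"
proof -
  have E: "map_matrix series_u (map_matrix (\<lambda>c. fps_const (scalar c)) E) = embed_mat E"
    "map_matrix series_v (map_matrix (\<lambda>c. fps_const (scalar c)) E) = embed_mat E"
    by (simp_all add: vec_eq_iff embed_mat_def series_const)
  have "subst_series E h (series_u (gen_matrix $ i $ j)) = series_u (subst_matrix E h $ i $ j)"
    "subst_series E h (series_v (gen_matrix $ i $ j)) = series_v (subst_matrix E h $ i $ j)" for i j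
    by (rule fls_fls_eqI; auto simp: subst_series_nth series_u_def series_v_def gen_matrix_def
      subst_hom_gen unital_hom_zero[OF unital_hom_subst_hom])+
  then have
    "map_matrix (subst_series E h) (map_matrix series_u gen_matrix) =
      map_matrix series_u (subst_matrix E h)"
    "map_matrix (subst_series E h) (map_matrix series_v gen_matrix) =
      map_matrix series_v (subst_matrix E h)"
    by (simp_all add: vec_eq_iff)
  then show
    "map_matrix (subst_series E h) (map_matrix series_u gen_matrix) =
      map_matrix series_u (map_matrix (fps_subst scalar h) gen_matrix) ** embed_mat E"
    "map_matrix (subst_series E h) (map_matrix series_v gen_matrix) =
      map_matrix series_v (map_matrix (fps_subst scalar h) gen_matrix) ** embed_mat E"
    unfolding subst_matrix_def map_matrix_mult[OF unital_hom_series_u]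
      map_matrix_mult[OF unital_hom_series_v] E by simp_all
qed

lemma subst_series_X1:
  assumes "fls_subdegree h = 1"
  shows "map_matrix (subst_series E h) X1_u =
    map_matrix (double_subst h) X1_u ** (embed_mat E \<otimes>\<^sub>k mat 1)"
proof -
  have "map_matrix (double_subst h) (map_matrix series_u gen_matrix) =
      map_matrix series_u (map_matrix (fps_subst scalar h) gen_matrix)"
    by (simp add: vec_eq_iff double_subst_series_u[OF assms])
  then show ?thesis
    unfolding X1_u_def map_matrix_kron[OF unital_hom_subst_series]
      map_matrix_kron[OF unital_hom_double_subst[OF assms]] subst_series_gen_matrix
      map_matrix_mat1[OF unital_hom_subst_series]
      map_matrix_mat1[OF unital_hom_double_subst[OF assms]]
    by (simp add: kron_mat1_right_mult)
qed

lemma subst_series_X2: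
  assumes "fls_subdegree h = 1"
  shows "map_matrix (subst_series E h) X2_v =
    map_matrix (double_subst h) X2_v ** (mat 1 \<otimes>\<^sub>k embed_mat E)"
proof -
  have "map_matrix (double_subst h) (map_matrix series_v gen_matrix) =
      map_matrix series_v (map_matrix (fps_subst scalar h) gen_matrix)"
    by (simp add: vec_eq_iff double_subst_series_v[OF assms])
  then show ?thesis
    unfolding X2_v_def map_matrix_kron[OF unital_hom_subst_series]
      map_matrix_kron[OF unital_hom_double_subst[OF assms]] subst_series_gen_matrix
      map_matrix_mat1[OF unital_hom_subst_series]
      map_matrix_mat1[OF unital_hom_double_subst[OF assms]]
    by (simp add: kron_mat1_left_mult)
qed

section \<open>Transformation of the relators\<close>

definition mat_ideal :: "'a set \<Rightarrow> ('a^'n^'m) set" where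
  "mat_ideal J = {M. \<forall>i j. M $ i $ j \<in> J}"

lemma mat_ideal_mult_left: "two_sided J \<Longrightarrow> M \<in> mat_ideal J \<Longrightarrow> A ** M \<in> mat_ideal J"
  by (auto simp: mat_ideal_def matrix_matrix_mult_def intro!: two_sided_sum two_sided_mult_left)

lemma mat_ideal_mult_right: "two_sided J \<Longrightarrow> M \<in> mat_ideal J \<Longrightarrow> M ** A \<in> mat_ideal J"
  by (auto simp: mat_ideal_def matrix_matrix_mult_def intro!: two_sided_sum two_sided_mult_right)

lemma mat_ideal_unit_mult_iff:
  assumes J: "two_sided J" and "U' ** U = mat 1" "V ** V' = mat 1"
  shows "U ** M ** V \<in> mat_ideal J \<longleftrightarrow> M \<in> mat_ideal J"
proof
  assume "U ** M ** V \<in> mat_ideal J"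
  then have "U' ** (U ** M ** V) ** V' \<in> mat_ideal J"
    by (simp add: mat_ideal_mult_left[OF J] mat_ideal_mult_right[OF J])
  also have "U' ** (U ** M ** V) ** V' = (U' ** U) ** M ** (V ** V')"
    by (simp only: matrix_mul_assoc)
  also have "\<dots> = M" by (simp add: assms)
  finally show "M \<in> mat_ideal J" .
qed (simp add: mat_ideal_mult_left[OF J] mat_ideal_mult_right[OF J])

lemma mat_mult_entry: "(mat c ** M) $ i $ j = c * M $ i $ j" "(M ** mat c) $ i $ j = M $ i $ j * c"
  for c :: "'a::semiring_1"
  by (simp_all add: matrix_matrix_mult_def mat_def if_distrib[of "\<lambda>x. x * _"] if_distrib[of "\<lambda>x. _ * x"]
      sum.delta sum.delta' cong: if_cong)

lemma mat_mult_mat: "mat c ** mat d = mat (c * d)" for c :: "'a::semiring_1"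
  by (auto simp: vec_eq_iff mat_mult_entry) (auto simp: mat_def)

lemma map_matrix_mat:
  assumes "unital_hom f"
  shows "map_matrix f (mat c) = mat (f c)"
  by (simp add: vec_eq_iff mat_def unital_hom_simps[OF assms])

definition relation_diff :: "'a::ring_1^'n^'n \<Rightarrow> 'a^'n^'n \<Rightarrow> 'a^'n^'n \<Rightarrow> 'a^'n^'n \<Rightarrow> 'a^'n^'n" where
  "relation_diff A B Y1 Y2 = A ** Y1 ** B ** Y2 - Y2 ** B ** Y1 ** A"

lemma map_matrix_relation_diff:
  assumes "unital_hom f"
  shows "map_matrix f (relation_diff A B Y1 Y2) =
    relation_diff (map_matrix f A) (map_matrix f B) (map_matrix f Y1) (map_matrix f Y2)"
  by (simp add: relation_diff_def map_matrix_diff[OF assms] map_matrix_mult[OF assms])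

text \<open>In the first product E1 is carried to the right through B and Y2, in the second E2 is
  carried through B and Y1; passing B turns it into D B'. As E1 E2 commutes with A', both products
  acquire the same outer factors C D and E1 E2. Y1 and Y2 keep their order throughout.\<close>

lemma relation_diff_factor:
  fixes A A' B B' C D E1 E2 Y1 Y2 :: "'a::ring_1^'n^'n"
  assumes A: "A = C ** A'"
    and B: "E1 ** B = D ** B' ** E1" "E2 ** B = D ** B' ** E2"
    and A': "A' ** (E1 ** E2) = E1 ** E2 ** A'"
    and Y: "Y1 ** E2 = E2 ** Y1" "Y2 ** E1 = E1 ** Y2"
    and E: "E2 ** E1 = E1 ** E2"
    and C: "\<And>M. M ** C = C ** M" and D: "\<And>M. M ** D = D ** M"
  shows "relation_diff A B (Y1 ** E1) (Y2 ** E2) =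
    (C ** D) ** relation_diff A' B' Y1 Y2 ** (E1 ** E2)"
proof -
  have "A ** (Y1 ** E1) ** B ** (Y2 ** E2) = C ** A' ** Y1 ** (E1 ** B) ** Y2 ** E2"
    by (simp only: A matrix_mul_assoc)
  also have "\<dots> = C ** (A' ** Y1) ** D ** B' ** (E1 ** Y2) ** E2"
    by (simp only: B matrix_mul_assoc)
  also have "\<dots> = C ** (A' ** Y1 ** D) ** B' ** (Y2 ** E1) ** E2"
    by (simp only: Y matrix_mul_assoc)
  also have "\<dots> = (C ** D) ** (A' ** Y1 ** B' ** Y2) ** (E1 ** E2)"
    by (simp only: D[of "A' ** Y1"]) (simp only: matrix_mul_assoc)
  finally have 1: "A ** (Y1 ** E1) ** B ** (Y2 ** E2) =
    (C ** D) ** (A' ** Y1 ** B' ** Y2) ** (E1 ** E2)" .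
  have "(Y2 ** E2) ** B ** (Y1 ** E1) ** A = Y2 ** (E2 ** B) ** Y1 ** (E1 ** C) ** A'"
    by (simp only: A matrix_mul_assoc)
  also have "\<dots> = (Y2 ** D) ** B' ** (E2 ** Y1) ** C ** E1 ** A'"
    by (simp only: B C matrix_mul_assoc)
  also have "\<dots> = (D ** Y2 ** B' ** Y1 ** E2 ** C) ** E1 ** A'"
    by (simp only: D[of Y2] Y(1)[symmetric] matrix_mul_assoc)
  also have "\<dots> = C ** D ** Y2 ** B' ** Y1 ** ((E2 ** E1) ** A')"
    by (simp only: C[of "D ** Y2 ** B' ** Y1 ** E2"]) (simp only: matrix_mul_assoc)
  also have "\<dots> = (C ** D) ** (Y2 ** B' ** Y1 ** A') ** (E1 ** E2)"
    by (simp only: E A'[symmetric]) (simp only: matrix_mul_assoc)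
  finally have 2: "(Y2 ** E2) ** B ** (Y1 ** E1) ** A =
    (C ** D) ** (Y2 ** B' ** Y1 ** A') ** (E1 ** E2)" .
  show ?thesis
    unfolding relation_diff_def 1 2
    by (simp add: vec_eq_iff matrix_matrix_mult_def algebra_simps sum_subtractf sum_distrib_left sum_distrib_right)
qed

definition const_mat :: "complex mat2 \<Rightarrow> scal2 mat2" where
  "const_mat E = map_matrix const2 E"

lemma embed_mat_eq: "embed_mat E = map_matrix embed_scal2 (const_mat E)"
  by (simp add: vec_eq_iff embed_mat_def const_mat_def embed_scal2_const2)

lemma unital_hom_const2: "unital_hom (const2 :: 'a::ring_1 \<Rightarrow> _)"
  by (rule unital_homI) (simp_all add: const2_def fls_plus_const)

lemma relators_subset_iff:
  "relators C A B \<subseteq> I \<longleftrightarrow>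
    (\<forall>i j. gen i j 0 - scalar (C $ i $ j) \<in> I) \<and>
    relation_diff (scal2_matrix A) (scal2_matrix B) X1_u X2_v \<in> mat_ideal (fls_ideal (fls_ideal I))"
  unfolding relators_def mat_ideal_def fls_ideal_def relation_diff_def by blast

lemma subst_hom_image_relators:
  "subst_hom E h ` relators C A B \<subseteq> I \<longleftrightarrow>
    (\<forall>i j. subst_hom E h (gen i j 0 - scalar (C $ i $ j)) \<in> I) \<and>
    map_matrix (subst_series E h) (relation_diff (scal2_matrix A) (scal2_matrix B) X1_u X2_v)
      \<in> mat_ideal (fls_ideal (fls_ideal I))"
  unfolding image_subset_iff relators_def mat_ideal_def fls_ideal_def relation_diff_def
  unfolding mem_Collect_eq nth_map_matrix subst_series_nth by blast

section \<open>Bijectivity of the substitution endomorphism\<close>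

definition subst_coeff :: "complex mat2 \<Rightarrow> complex fls \<Rightarrow> idx \<Rightarrow> idx \<Rightarrow> nat \<Rightarrow> nat \<Rightarrow> complex" where
  "subst_coeff E h l j s r = fps_nth (fls_regpart h ^ s) r * E $ l $ j"

lemma subst_hom_gen_eq:
  assumes "fls_subdegree h = 1"
  shows "subst_hom E h (gen i j r) =
    (\<Sum>l\<in>UNIV. \<Sum>s=0..r. gen i l s * scalar (subst_coeff E h l j s r))"
  by (simp add: subst_hom_gen subst_matrix_def matrix_matrix_mult_def fps_sum_nth
      fps_subst_nth[OF unital_hom_scalar assms] gen_matrix_def sum_distrib_right mult.assoc
      subst_coeff_def unital_hom_mult[OF unital_hom_scalar])

text \<open>On generators the endomorphism is linear: it keeps the row index and acts on pairs
  (column, degree) by a tensor product of E with the coefficient matrix of the powers of h. Matrices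
  of this kind for h and h' multiply to the one of the composite series, here the identity series,
  and E squares to 1.\<close>

lemma subst_hom_subst_hom_gen:
  assumes h: "fls_subdegree h = 1" "fls_subdegree h' = 1"
    and inv: "fps_compose (fls_regpart h) (fls_regpart h') = fps_X"
    and E: "E ** E = mat 1"
  shows "subst_hom E h (subst_hom E h' (gen i j r)) = gen i j r"
proof -
  let ?g = "fls_regpart h" and ?g' = "fls_regpart h'"
  have g0: "fps_nth ?g 0 = 0" "fps_nth ?g' 0 = 0" using h by simp_all
  have comp: "(\<Sum>s=0..r. fps_nth (?g ^ t) s * fps_nth (?g' ^ s) r) = (if t = r then 1 else 0)" for t
  proof -
    have "(\<Sum>s=0..r. fps_nth (?g ^ t) s * fps_nth (?g' ^ s) r) = fps_nth (fps_compose (?g ^ t) ?g') r"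
      by (simp add: fps_compose_nth)
    also have "fps_compose (?g ^ t) ?g' = fps_X ^ t"
      using fps_compose_power[OF g0(2), of ?g t] inv by simp
    finally show ?thesis by simp
  qed
  have E': "(\<Sum>l\<in>UNIV. E $ m $ l * E $ l $ j) = (if m = j then 1 else 0)" for m
    using E by (simp add: vec_eq_iff matrix_matrix_mult_def mat_def)
  have coeff: "(\<Sum>l\<in>UNIV. \<Sum>s=0..r. subst_coeff E h m l t s * subst_coeff E h' l j s r) =
      (if m = j \<and> t = r then 1 else 0)" for m t
  proof -
    have "(\<Sum>l\<in>UNIV. \<Sum>s=0..r. subst_coeff E h m l t s * subst_coeff E h' l j s r) =
        (\<Sum>l\<in>UNIV. E $ m $ l * E $ l $ j) * (\<Sum>s=0..r. fps_nth (?g ^ t) s * fps_nth (?g' ^ s) r)"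
      by (simp add: sum_product subst_coeff_def algebra_simps)
    then show ?thesis unfolding comp E' by simp
  qed
  \<comment> \<open>The degree sum may run up to r instead of s, since h^t has no coefficient below
    order t; all summands then share one range.\<close>
  have ext: "subst_hom E h (gen i l s) =
      (\<Sum>m\<in>UNIV. \<Sum>t=0..r. gen i m t * scalar (subst_coeff E h m l t s))" if "s \<le> r" for l s
    unfolding subst_hom_gen_eq[OF h(1)] using that
    by (intro sum.cong refl sum.mono_neutral_left)
      (auto simp: subst_coeff_def startsby_zero_power_prefix[OF g0(1)] unital_hom_zero[OF unital_hom_scalar])
  have "subst_hom E h (subst_hom E h' (gen i j r)) =
      (\<Sum>l\<in>UNIV. \<Sum>s=0..r. subst_hom E h (gen i l s) * scalar (subst_coeff E h' l j s r))"
    by (simp add: subst_hom_gen_eq[OF h(2)] unital_hom_sum[OF unital_hom_subst_hom]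
        unital_hom_mult[OF unital_hom_subst_hom])
  also have "\<dots> = (\<Sum>l\<in>UNIV. \<Sum>s=0..r. \<Sum>m\<in>UNIV. \<Sum>t=0..r.
      gen i m t * scalar (subst_coeff E h m l t s * subst_coeff E h' l j s r))"
    by (simp add: ext sum_distrib_right mult.assoc unital_hom_mult[OF unital_hom_scalar])
  also have "\<dots> = (\<Sum>m\<in>UNIV. \<Sum>l\<in>UNIV. \<Sum>s=0..r. \<Sum>t=0..r.
      gen i m t * scalar (subst_coeff E h m l t s * subst_coeff E h' l j s r))"
    by (subst sum.swap[of _ UNIV UNIV]) (intro sum.cong refl sum.swap)
  also have "\<dots> = (\<Sum>m\<in>UNIV. \<Sum>t=0..r. \<Sum>l\<in>UNIV. \<Sum>s=0..r.
      gen i m t * scalar (subst_coeff E h m l t s * subst_coeff E h' l j s r))"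
    by (subst (2) sum.swap, subst (3) sum.swap) simp
  also have "\<dots> = (\<Sum>m\<in>UNIV. \<Sum>t=0..r. gen i m t *
      scalar (\<Sum>l\<in>UNIV. \<Sum>s=0..r. subst_coeff E h m l t s * subst_coeff E h' l j s r))"
    by (simp add: unital_hom_sum[OF unital_hom_scalar] sum_distrib_left)
  also have "\<dots> = (\<Sum>m\<in>UNIV. \<Sum>t=0..r. if t = r then if m = j then gen i m t else 0 else 0)"
    unfolding coeff by (intro sum.cong refl) (simp add: unital_hom_simps[OF unital_hom_scalar])
  also have "\<dots> = gen i j r"
    by (simp add: sum.delta)
  finally show ?thesis .
qed

text \<open>The inverse is the substitution with the compositional inverse of h and the same E. This
  already holds in the free algebra, before any relation is imposed.\<close>

lemma bij_subst_hom:
  assumes h: "fls_subdegree h = 1" and E: "E ** E = mat 1"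
  shows "bij (subst_hom E h)"
proof -
  define g where "g = fls_regpart h"
  define h' where "h' = fps_to_fls (fps_inv g)"
  have g: "fps_nth g 0 = 0" "fps_nth g 1 \<noteq> 0"
    using h powi_nth_self_neq_0[OF h, of 1] by (simp_all add: g_def)
  have inv0: "fps_nth (fps_inv g) 0 = 0" "fps_nth (fps_inv g) 1 \<noteq> 0"
    using g by (simp_all add: fps_inv_def)
  then have "subdegree (fps_inv g) = 1" by (intro subdegreeI) auto
  then have h': "fls_subdegree h' = 1" by (simp add: h'_def fls_subdegree_fls_to_fps)
  have reg: "fls_regpart h' = fps_inv g" by (simp add: h'_def)
  have 1: "subst_hom E h (subst_hom E h' x) = x" for x
    by (rule free_lift_identity[OF unital_hom_compose[OF unital_hom_subst_hom unital_hom_subst_hom]])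
      (simp_all add: subst_hom_subst_hom_gen[OF h h' _ E] reg fps_inv_right[OF g] flip: g_def)
  have 2: "subst_hom E h' (subst_hom E h x) = x" for x
    by (rule free_lift_identity[OF unital_hom_compose[OF unital_hom_subst_hom unital_hom_subst_hom]])
      (simp_all add: subst_hom_subst_hom_gen[OF h' h _ E] reg fps_inv[OF g] flip: g_def)
  show ?thesis using 1 2 by (metis bijI')
qed

section \<open>Presented algebras\<close>

lemma scal2_matrix_eq: "scal2_matrix = map_matrix embed_scal2"
  by (simp add: scal2_matrix_def embed_scal2_def)

lemma central_mat_commute:
  assumes "central_hom \<iota>"
  shows "M ** mat (\<iota> c) = mat (\<iota> c) ** M"
  using assms by (simp add: vec_eq_iff mat_mult_entry central_hom_def)

text \<open>\<open>A''\<close> and \<open>B''\<close> are the target R-matrices after the change of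
  variables; the hypotheses say that they match the source ones up to the scalars \<open>a\<close>,
  \<open>b\<close> and the passage of E. The image of the source relation is then the target
  relation in the new variables between invertible factors, and neither the factors nor the change
  of variables affects membership in I.\<close>

lemma subst_hom_image_relators_iff:
  assumes h: "fls_subdegree h = 1" and E: "E ** E = mat 1" and C: "C = C' ** E"
    and A'': "map_matrix (double_subst h) (scal2_matrix A') = scal2_matrix A''"
    and B'': "map_matrix (double_subst h) (scal2_matrix B') = scal2_matrix B''"
    and A: "A = mat a ** A''" "a \<noteq> 0"
    and comm: "A'' ** ((const_mat E \<otimes>\<^sub>k mat 1) ** (mat 1 \<otimes>\<^sub>k const_mat E)) =
      (const_mat E \<otimes>\<^sub>k mat 1) ** (mat 1 \<otimes>\<^sub>k const_mat E) ** A''"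
    and B: "(const_mat E \<otimes>\<^sub>k mat 1) ** B = mat b ** B'' ** (const_mat E \<otimes>\<^sub>k mat 1)"
      "(mat 1 \<otimes>\<^sub>k const_mat E) ** B = mat b ** B'' ** (mat 1 \<otimes>\<^sub>k const_mat E)" "b \<noteq> 0"
    and I: "two_sided I"
  shows "subst_hom E h ` relators C A B \<subseteq> I \<longleftrightarrow> relators C' A' B' \<subseteq> I"
proof -
  define J where "J = fls_ideal (fls_ideal I)"
  have J: "two_sided J" unfolding J_def by (intro two_sided_fls_ideal I)
  define E1 where "E1 = embed_mat E \<otimes>\<^sub>k mat 1"
  define E2 where "E2 = mat 1 \<otimes>\<^sub>k embed_mat E"
  have emb: "map_matrix embed_scal2 (const_mat E \<otimes>\<^sub>k mat 1) = E1"
    "map_matrix embed_scal2 (mat 1 \<otimes>\<^sub>k const_mat E) = E2"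
    by (simp_all add: map_matrix_kron[OF unital_hom_embed_scal2] map_matrix_mat1[OF unital_hom_embed_scal2]
        E1_def E2_def embed_mat_eq)
  have central: "embed_mat E $ i $ j * F = F * embed_mat E $ i $ j" for i j F
    by (simp add: embed_mat_def const2_scalar_central)
  note emb_mult = map_matrix_mult[OF unital_hom_embed_scal2]
  have 1: "scal2_matrix A = mat (embed_scal2 a) ** scal2_matrix A''"
    by (simp add: A(1) scal2_matrix_eq emb_mult map_matrix_mat[OF unital_hom_embed_scal2])
  have 2: "E1 ** scal2_matrix B = mat (embed_scal2 b) ** scal2_matrix B'' ** E1"
    "E2 ** scal2_matrix B = mat (embed_scal2 b) ** scal2_matrix B'' ** E2"
    using B(1,2)[THEN arg_cong[of _ _ "map_matrix embed_scal2"]]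
    by (simp_all add: scal2_matrix_eq emb_mult map_matrix_mat[OF unital_hom_embed_scal2] emb)
  have 3: "scal2_matrix A'' ** (E1 ** E2) = E1 ** E2 ** scal2_matrix A''"
    using comm[THEN arg_cong[of _ _ "map_matrix embed_scal2"]] by (simp add: scal2_matrix_eq emb_mult emb)
  let ?Y1 = "map_matrix (double_subst h) X1_u" and ?Y2 = "map_matrix (double_subst h) X2_v"
  note hom = unital_hom_double_subst[OF h]
  have Y1: "?Y1 ** E2 = E2 ** ?Y1"
    unfolding X1_u_def E2_def map_matrix_kron[OF hom] map_matrix_mat1[OF hom]
    by (rule kron_mat1_commute) (simp add: central)
  have Y2: "?Y2 ** E1 = E1 ** ?Y2"
    unfolding X2_v_def E1_def map_matrix_kron[OF hom] map_matrix_mat1[OF hom]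
    by (rule kron_mat1_commute[symmetric]) (simp add: central)
  have E21: "E2 ** E1 = E1 ** E2"
    unfolding E1_def E2_def by (rule kron_mat1_commute[symmetric]) (rule central)
  have "embed_mat E ** embed_mat E = mat 1"
  proof -
    have "const_mat E ** const_mat E = mat 1"
      unfolding const_mat_def
      by (simp add: E map_matrix_mat1[OF unital_hom_const2] flip: map_matrix_mult[OF unital_hom_const2])
    then show ?thesis
      by (simp add: embed_mat_eq map_matrix_mat1[OF unital_hom_embed_scal2] flip: emb_mult)
  qed
  then have sq: "E1 ** E1 = mat 1" "E2 ** E2 = mat 1"
    by (simp_all add: E1_def E2_def kron_mat1_right_mult kron_mat1_left_mult kron_mat1)
  let ?D = "relation_diff (scal2_matrix A') (scal2_matrix B') X1_u X2_v"
  let ?C = "mat (embed_scal2 a) ** mat (embed_scal2 b) :: free fls fls mat4"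
  have "map_matrix (subst_series E h) (scal2_matrix M) = scal2_matrix M" for M
    by (simp add: scal2_matrix_eq vec_eq_iff subst_series_embed_scal2)
  then have "map_matrix (subst_series E h) (relation_diff (scal2_matrix A) (scal2_matrix B) X1_u X2_v) =
      relation_diff (scal2_matrix A) (scal2_matrix B) (?Y1 ** E1) (?Y2 ** E2)"
    by (simp add: map_matrix_relation_diff[OF unital_hom_subst_series] subst_series_X1[OF h]
        subst_series_X2[OF h] E1_def E2_def)
  also have "\<dots> = ?C ** relation_diff (scal2_matrix A'') (scal2_matrix B'') ?Y1 ?Y2 ** (E1 ** E2)"
    by (rule relation_diff_factor[OF 1 2 3 Y1 Y2 E21])
      (rule central_mat_commute[OF central_hom_embed_scal2])+
  also have "relation_diff (scal2_matrix A'') (scal2_matrix B'') ?Y1 ?Y2 = map_matrix (double_subst h) ?D"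
    by (simp add: map_matrix_relation_diff[OF hom] A'' B'')
  finally have eq: "map_matrix (subst_series E h) (relation_diff (scal2_matrix A) (scal2_matrix B) X1_u X2_v) =
      ?C ** map_matrix (double_subst h) ?D ** (E1 ** E2)" .
  have inv: "inverse b * inverse a * (a * b) = 1" using A(2) B(3) by (simp add: field_simps)
  have "(mat (embed_scal2 (inverse b)) ** mat (embed_scal2 (inverse a))) ** ?C = mat 1"
    using inv
    by (simp add: mat_mult_mat unital_hom_one[OF unital_hom_embed_scal2] flip: unital_hom_mult[OF unital_hom_embed_scal2])
  moreover have "(E1 ** E2) ** (E2 ** E1) = mat 1"
  proof -
    have "(E1 ** E2) ** (E2 ** E1) = E1 ** (E2 ** E2) ** E1" by (simp only: matrix_mul_assoc)
    then show ?thesis by (simp add: sq)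
  qed
  ultimately have "?C ** map_matrix (double_subst h) ?D ** (E1 ** E2) \<in> mat_ideal J \<longleftrightarrow>
      map_matrix (double_subst h) ?D \<in> mat_ideal J"
    by (rule mat_ideal_unit_mult_iff[OF J])
  also have "\<dots> \<longleftrightarrow> ?D \<in> mat_ideal J"
    by (simp add: mat_ideal_def J_def double_subst_mem_iff[OF h I])
  finally have rel: "map_matrix (subst_series E h)
      (relation_diff (scal2_matrix A) (scal2_matrix B) X1_u X2_v) \<in> mat_ideal J \<longleftrightarrow> ?D \<in> mat_ideal J"
    unfolding eq .
  \<comment> \<open>Since h has no constant term, X(w(u)) E has constant term X^(0) E. The image of
    X^(0) - C is therefore (X^(0) - C') E, with E invertible.\<close>
  let ?G = "\<chi> i j. gen i j 0 - scalar (C' $ i $ j)" and ?E = "map_matrix scalar E"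
  have "(\<chi> i j. subst_hom E h (gen i j 0 - scalar (C $ i $ j))) = mat 1 ** ?G ** ?E"
    unfolding matrix_mul_lid
    by (simp add: vec_eq_iff C unital_hom_diff[OF unital_hom_subst_hom] subst_hom_gen_eq[OF h]
        subst_coeff_def matrix_matrix_mult_def unital_hom_sum[OF unital_hom_scalar]
        unital_hom_sum[OF unital_hom_subst_hom] unital_hom_mult[OF unital_hom_subst_hom]
        unital_hom_mult[OF unital_hom_scalar] left_diff_distrib sum_subtractf)
  moreover have "?E ** ?E = mat 1"
    by (simp add: E map_matrix_mat1[OF unital_hom_scalar] flip: map_matrix_mult[OF unital_hom_scalar])
  ultimately have "(\<chi> i j. subst_hom E h (gen i j 0 - scalar (C $ i $ j))) \<in> mat_ideal I \<longleftrightarrow>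
      ?G \<in> mat_ideal I"
    using mat_ideal_unit_mult_iff[OF I, of "mat 1" "mat 1" ?E ?E ?G] by simp
  then show ?thesis
    unfolding subst_hom_image_relators relators_subset_iff using rel
    by (simp add: mat_ideal_def J_def)
qed

section \<open>Ideals of the free algebra and their quotients\<close>

abbreviation ideal_of :: "free set \<Rightarrow> free set" where
  "ideal_of S \<equiv> Idl\<^bsub>free_algebra\<^esub> S"

text \<open>Passes between the ideals used to form the quotient and the type-based
  \<open>two_sided\<close>, which applies equally to Laurent series rings. Closure under negation
  comes from multiplying by -1.\<close>

lemma ideal_free_algebra_iff: "ideal I free_algebra \<longleftrightarrow> two_sided I"
proof
  assume "ideal I free_algebra"
  then interpret ideal I free_algebra .
  show "two_sided I"
    using I_l_closed I_r_closed additive_subgroup.zero_closed[OF additive_subgroup_axioms]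
      additive_subgroup.a_closed[OF additive_subgroup_axioms]
    by (auto simp: two_sided_def free_algebra_def)
next
  assume I: "two_sided I"
  interpret ring free_algebra by (rule ring_free_algebra)
  have minus: "\<ominus>\<^bsub>free_algebra\<^esub> x = - x" for x
    by (rule minus_equality) (simp_all add: free_algebra_def)
  show "ideal I free_algebra"
  proof (rule idealI)
    show "subgroup I (add_monoid free_algebra)"
      using minus two_sided_zero[OF I]
      by (intro group.subgroupI a_group)
        (auto simp: a_inv_def[symmetric] two_sided_uminus[OF I] two_sided_add[OF I], 
         auto simp: free_algebra_def two_sided_add[OF I])
  qed (auto simp: ring_free_algebra, auto simp: free_algebra_def two_sided_mult_left[OF I] two_sided_mult_right[OF I])
qed

lemma
  shows ideal_ideal_of: "ideal (ideal_of S) free_algebra"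
    and ideal_of_self: "S \<subseteq> ideal_of S"
    and ideal_of_minimal: "two_sided I \<Longrightarrow> S \<subseteq> I \<Longrightarrow> ideal_of S \<subseteq> I"
proof -
  interpret ring free_algebra by (rule ring_free_algebra)
  have S: "S \<subseteq> carrier free_algebra" by (simp add: free_algebra_def)
  show "ideal (ideal_of S) free_algebra" "S \<subseteq> ideal_of S"
    using S by (rule genideal_ideal, rule genideal_self)
  show "two_sided I \<Longrightarrow> S \<subseteq> I \<Longrightarrow> ideal_of S \<subseteq> I"
    using genideal_minimal ideal_free_algebra_iff by blast
qed

lemma two_sided_ideal_of: "two_sided (ideal_of S)"
  using ideal_ideal_of ideal_free_algebra_iff by blast

text \<open>The two inclusions are the test against I = \<open>ideal_of T\<close> and against the
  image of \<open>ideal_of S\<close>; the latter is an ideal because f is onto.\<close>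

lemma image_ideal_of:
  assumes f: "unital_hom f" "bij f"
    and sub: "\<And>I. two_sided I \<Longrightarrow> f ` S \<subseteq> I \<longleftrightarrow> T \<subseteq> I"
  shows "f ` ideal_of S = ideal_of T"
proof
  have "two_sided (f -` ideal_of T)"
    using two_sided_ideal_of[of T] by (simp add: two_sided_def unital_hom_simps[OF f(1)])
  moreover have "S \<subseteq> f -` ideal_of T"
    using sub[OF two_sided_ideal_of, of T] ideal_of_self[of T] by auto
  ultimately show "f ` ideal_of S \<subseteq> ideal_of T"
    using ideal_of_minimal[of "f -` ideal_of T" S] by auto
  have "two_sided (f ` ideal_of S)"
    unfolding two_sided_def
  proof (intro conjI ballI allI)
    show "0 \<in> f ` ideal_of S"
      using two_sided_zero[OF two_sided_ideal_of] unital_hom_zero[OF f(1)] by (metis imageI)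
    fix x assume "x \<in> f ` ideal_of S"
    then obtain x' where x': "x = f x'" "x' \<in> ideal_of S" by blast
    show "x + y \<in> f ` ideal_of S" if "y \<in> f ` ideal_of S" for y
      using that x' two_sided_add[OF two_sided_ideal_of] unital_hom_add[OF f(1), symmetric] by auto
    fix y
    obtain y' where "y = f y'" using f(2) by (metis bij_pointE)
    then show "x * y \<in> f ` ideal_of S" "y * x \<in> f ` ideal_of S"
      using x' two_sided_mult_right[OF two_sided_ideal_of] two_sided_mult_left[OF two_sided_ideal_of]
      by (auto simp flip: unital_hom_mult[OF f(1)])
  qed
  moreover have "T \<subseteq> f ` ideal_of S"
    using sub[OF calculation] ideal_of_self[of S] by blast
  ultimately show "ideal_of T \<subseteq> f ` ideal_of S"
    by (rule ideal_of_minimal)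
qed

lemma coset_eq: "coset S x = (\<lambda>i. i + x) ` ideal_of S"
  by (auto simp: coset_def a_r_coset_def' free_algebra_def)

lemma coset_self: "x \<in> coset S x"
  unfolding coset_eq using two_sided_zero[OF two_sided_ideal_of] by force

lemma coset_eqI: "y \<in> coset S x \<Longrightarrow> coset S y = coset S x"
proof -
  interpret ideal "ideal_of S" free_algebra by (rule ideal_ideal_of)
  show "y \<in> coset S x \<Longrightarrow> coset S y = coset S x"
    unfolding coset_def by (rule a_repr_independence'[symmetric]) (simp_all add: free_algebra_def)
qed

lemma
  shows presented_carrier: "carrier (presented_algebra S) = range (coset S)"
    and presented_mult: "coset S x \<otimes>\<^bsub>presented_algebra S\<^esub> coset S y = coset S (x * y)"
    and presented_add: "coset S x \<oplus>\<^bsub>presented_algebra S\<^esub> coset S y = coset S (x + y)"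
    and presented_one: "\<one>\<^bsub>presented_algebra S\<^esub> = coset S 1"
    and presented_smult: "c \<odot>\<^bsub>presented_algebra S\<^esub> coset S x = coset S (scalar c * x)"
proof -
  interpret ideal "ideal_of S" free_algebra by (rule ideal_ideal_of)
  have carrier: "carrier free_algebra = UNIV" by (simp add: free_algebra_def)
  have rcosets: "a_rcosets\<^bsub>free_algebra\<^esub> (ideal_of S) = (\<Union>x\<in>carrier free_algebra. {coset S x})"
    by (simp add: A_RCOSETS_defs coset_def a_r_coset_def)
  note defs = presented_algebra_def ring.defs module.defs FactRing_def
  show "carrier (presented_algebra S) = range (coset S)"
    by (auto simp: defs rcosets carrier)
  show "coset S x \<otimes>\<^bsub>presented_algebra S\<^esub> coset S y = coset S (x * y)"
    using rcoset_mult_add[of x y] by (simp add: defs coset_def) (simp add: free_algebra_def)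
  show "coset S x \<oplus>\<^bsub>presented_algebra S\<^esub> coset S y = coset S (x + y)"
    using a_rcos_sum[of x y] by (simp add: defs coset_def) (simp add: free_algebra_def)
  show "\<one>\<^bsub>presented_algebra S\<^esub> = coset S 1"
    by (simp add: defs coset_def) (simp add: free_algebra_def)
  \<comment> \<open>The scalar multiplication of the quotient is a union over all representatives.
    Each of them contributes the same coset, and \<open>coset_self\<close> shows that there is
    one.\<close>
  have eq: "coset S (scalar c * y) = coset S (scalar c * x)" if "y \<in> coset S x" for y
  proof -
    obtain i where "i \<in> ideal_of S" "y = i + x" using \<open>y \<in> coset S x\<close> unfolding coset_eq by blast
    then have "scalar c * y \<in> coset S (scalar c * x)"
      unfolding coset_eq using two_sided_mult_left[OF two_sided_ideal_of, of i S "scalar c"]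
      by (auto simp: distrib_left)
    then show ?thesis by (rule coset_eqI)
  qed
  have "(\<Union>y\<in>coset S x. coset S (scalar c * y)) = coset S (scalar c * x)"
    by (rule UN_constant_eq[OF coset_self[of x S]]) (intro ballI eq)
  then show "c \<odot>\<^bsub>presented_algebra S\<^esub> coset S x = coset S (scalar c * x)"
    by (simp add: defs) (simp add: free_algebra_def)
qed

lemma image_coset:
  assumes "unital_hom f" "f ` ideal_of S = ideal_of T"
  shows "f ` coset S x = coset T (f x)"
  unfolding coset_eq assms(2)[symmetric] by (simp add: image_image unital_hom_add[OF assms(1)])

text \<open>An automorphism matching the ideals maps cosets onto cosets, so taking direct images is
  itself the isomorphism and no representatives have to be chosen.\<close>

lemma algebra_iso_image:
  assumes f: "unital_hom f" "bij f" "\<And>c. f (scalar c) = scalar c" and im: "f ` ideal_of S = ideal_of T"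
  shows "algebra_iso (presented_algebra S) (presented_algebra T) (image f)"
proof -
  note co = image_coset[OF f(1) im]
  have "bij_betw (image f) (range (coset S)) (range (coset T))"
  proof (rule bij_betw_imageI)
    show "inj_on (image f) (range (coset S))"
      using f(2) by (meson bij_is_inj inj_image_eq_iff inj_onI)
    show "image f ` range (coset S) = range (coset T)"
      using bij_is_surj[OF f(2)] by (simp add: image_image co) (metis image_image)
  qed
  moreover have "f ` (X \<otimes>\<^bsub>presented_algebra S\<^esub> Y) = f ` X \<otimes>\<^bsub>presented_algebra T\<^esub> f ` Y"
    "f ` (X \<oplus>\<^bsub>presented_algebra S\<^esub> Y) = f ` X \<oplus>\<^bsub>presented_algebra T\<^esub> f ` Y"
    if XY: "X \<in> range (coset S)" "Y \<in> range (coset S)" for X Y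
  proof -
    from XY obtain x y where "X = coset S x" "Y = coset S y" by blast
    then show "f ` (X \<otimes>\<^bsub>presented_algebra S\<^esub> Y) = f ` X \<otimes>\<^bsub>presented_algebra T\<^esub> f ` Y"
      "f ` (X \<oplus>\<^bsub>presented_algebra S\<^esub> Y) = f ` X \<oplus>\<^bsub>presented_algebra T\<^esub> f ` Y"
      by (simp_all only: presented_mult presented_add co unital_hom_simps[OF f(1)])
  qed
  moreover have "f ` X \<in> range (coset T)" if "X \<in> range (coset S)" for X
    using that by (auto simp only: co intro: rangeI)
  ultimately have "image f \<in> ring_iso (presented_algebra S) (presented_algebra T)"
    by (intro ring_iso_memI)
      (simp_all only: presented_carrier presented_one co unital_hom_one[OF f(1)])
  then show ?thesis
    by (auto simp: algebra_iso_def presented_carrier presented_smult co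
        unital_hom_mult[OF f(1)] f(3))
qed

section \<open>R-matrices\<close>

text \<open>Reduces each isomorphism to matrix identities over the commutative field
  \<open>scal2\<close>, apart from the action of \<open>double_subst\<close> on the target
  R-matrices.\<close>

lemma defines_algebra_iso_relators:
  assumes h: "fls_subdegree h = 1" and E: "E ** E = mat 1" and C: "C = C' ** E"
    and A'': "map_matrix (double_subst h) (scal2_matrix A') = scal2_matrix A''"
    and B'': "map_matrix (double_subst h) (scal2_matrix B') = scal2_matrix B''"
    and A: "A = mat a ** A''" "a \<noteq> 0"
    and comm: "A'' ** ((const_mat E \<otimes>\<^sub>k mat 1) ** (mat 1 \<otimes>\<^sub>k const_mat E)) =
      (const_mat E \<otimes>\<^sub>k mat 1) ** (mat 1 \<otimes>\<^sub>k const_mat E) ** A''"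
    and B: "(const_mat E \<otimes>\<^sub>k mat 1) ** B = mat b ** B'' ** (const_mat E \<otimes>\<^sub>k mat 1)"
      "(mat 1 \<otimes>\<^sub>k const_mat E) ** B = mat b ** B'' ** (mat 1 \<otimes>\<^sub>k const_mat E)" "b \<noteq> 0"
  shows "defines_algebra_iso (relators C A B) (relators C' A' B') (subst_matrix E h)"
proof -
  note hom = unital_hom_subst_hom[of E h] and bij = bij_subst_hom[OF h E]
  have im: "subst_hom E h ` ideal_of (relators C A B) = ideal_of (relators C' A' B')"
    by (rule image_ideal_of[OF hom bij]) (rule subst_hom_image_relators_iff[OF assms])
  show ?thesis
    unfolding defines_algebra_iso_def
    using algebra_iso_image[OF hom bij subst_hom_scalar im] image_coset[OF hom im]
    by (auto simp: subst_hom_gen[symmetric])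
qed

lemma matP_entry: "matP $ (i, k) $ (j, l) = (if i = l \<and> k = j then 1 else 0)"
  by (cases i; cases j; cases k; cases l) (simp_all add: mat_entry_defs)

lemma Q_plus_entry: "Q_plus $ (i, k) $ (j, l) = (if k = - i \<and> l = - j then 1 else 0)"
  unfolding Q_plus_def
  by (cases i; cases j; cases k; cases l) (simp_all add: mat_entry_defs)

lemma Q_minus_entry:
  "Q_minus $ (i, k) $ (j, l) = (if k = - i \<and> l = - j then sign i * sign j else 0)"
  unfolding Q_minus_def
  by (cases i; cases j; cases k; cases l) (simp_all add: mat_entry_defs)

text \<open>P and both Q have entries 0, 1 or -1, which every unital homomorphism preserves, so only
  the scalar \<open>x\<close> is affected.\<close>

lemma double_subst_R:
  assumes h: "fls_subdegree h = 1"
    and x: "double_subst h (embed_scal2 x) = embed_scal2 y" "x \<noteq> 0" "y \<noteq> 0"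
  shows "map_matrix (double_subst h) (scal2_matrix (R_circ x)) = scal2_matrix (R_circ y)"
    and "map_matrix (double_subst h) (scal2_matrix (R_circ_t_plus x)) = scal2_matrix (R_circ_t_plus y)"
    and "map_matrix (double_subst h) (scal2_matrix (R_circ_t_minus x)) = scal2_matrix (R_circ_t_minus y)"
proof -
  define \<theta> where "\<theta> = (\<lambda>F. double_subst h (embed_scal2 F))"
  have \<theta>: "unital_hom \<theta>"
    unfolding \<theta>_def
    by (rule unital_hom_compose[OF unital_hom_double_subst[OF h] unital_hom_embed_scal2])
  have *: "map_matrix (double_subst h) (scal2_matrix (mat 1 - map_matrix (\<lambda>z. z / x) N)) =
      scal2_matrix (mat 1 - map_matrix (\<lambda>z. z / y) N)"
    if "\<And>p q. \<theta> (N $ p $ q) = embed_scal2 (N $ p $ q)" for N :: "scal2 mat4"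
  proof -
    have "\<theta> (inverse x) = embed_scal2 (inverse y)"
      unfolding \<theta>_def by (rule double_subst_inverse[OF h x])
    moreover have "\<theta> (mat 1 $ p $ q) = embed_scal2 (mat 1 $ p $ q)" for p q :: "idx \<times> idx"
      by (simp add: mat_def unital_hom_simps[OF \<theta>] unital_hom_simps[OF unital_hom_embed_scal2])
    ultimately show ?thesis
      unfolding scal2_matrix_eq vec_eq_iff nth_map_matrix \<theta>_def[THEN fun_cong, symmetric]
      by (simp add: divide_inverse that unital_hom_simps[OF \<theta>]
          unital_hom_simps[OF unital_hom_embed_scal2])
  qed
  have sign: "sign i * sign j = (if i = j then 1 else - 1 :: scal2)" for i j
    by (cases i; cases j) (simp_all add: sign_def)
  note [simp] = unital_hom_simps[OF \<theta>] unital_hom_simps[OF unital_hom_embed_scal2]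
  show "map_matrix (double_subst h) (scal2_matrix (R_circ x)) = scal2_matrix (R_circ y)"
    unfolding R_circ_def by (rule *) (auto simp: matP_entry)
  show "map_matrix (double_subst h) (scal2_matrix (R_circ_t_plus x)) = scal2_matrix (R_circ_t_plus y)"
    unfolding R_circ_t_plus_def by (rule *) (auto simp: Q_plus_entry)
  show "map_matrix (double_subst h) (scal2_matrix (R_circ_t_minus x)) = scal2_matrix (R_circ_t_minus y)"
    unfolding R_circ_t_minus_def by (rule *) (auto simp: Q_minus_entry sign)
qed

text \<open>P is the flip, equal to 1 on symmetric and -1 on antisymmetric tensors. Antisymmetric
  tensors over C^2 form a line, and Q^- is twice the projection onto it.\<close>

lemma matP_plus_Q_minus: "matP + Q_minus = (mat 1 :: 'a::ring_1 mat4)"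
proof -
  have "(matP + Q_minus) $ (i, k) $ (j, l) = (mat 1 :: 'a mat4) $ (i, k) $ (j, l)" for i j k l
    by (cases i; cases j; cases k; cases l)
      (simp_all add: matP_entry Q_minus_entry mat_def sign_def uminus_idx_def)
  then show ?thesis by (simp add: vec_eq_iff)
qed

text \<open>Eliminating Q^- leaves I with coefficient (x - 1)/(x - 2) and P with coefficient -2(x -
  1)/(x(x - 2)).\<close>

lemma R_sp2_eq_R_circ:
  assumes "x \<noteq> 0" "x - 2 \<noteq> 0"
  shows "R_sp2 x = mat ((x - 1) / (x - 2)) ** R_circ (x / 2)"
proof -
  have "R_sp2 x $ p $ q = (mat ((x - 1) / (x - 2)) ** R_circ (x / 2)) $ p $ q" for p q
  proof -
    have "mat 1 $ p $ q = matP $ p $ q + (Q_minus $ p $ q :: scal2)"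
      by (simp flip: matP_plus_Q_minus)
    then show ?thesis
      using assms by (simp add: R_sp2_def R_circ_def mat_mult_entry) (simp add: field_simps)
  qed
  then show ?thesis by (simp add: vec_eq_iff)
qed

text \<open>Eliminating P instead leaves I with coefficient (x - 1)/x and Q^- with coefficient 2(x -
  1)/(x(x - 2)).\<close>

lemma R_sp2_eq_R_circ_t_minus:
  assumes "x \<noteq> 0" "x - 2 \<noteq> 0"
  shows "R_sp2 x = mat ((x - 1) / x) ** R_circ_t_minus (1 - x / 2)"
proof -
  \<comment> \<open>This shape exposes the denominator x - 2, which is nonzero by
    assumption.\<close>
  have eq: "1 - x / 2 = - (x - 2) / 2" by (simp add: field_simps)
  have "R_sp2 x $ p $ q = (mat ((x - 1) / x) ** R_circ_t_minus (- (x - 2) / 2)) $ p $ q" for p q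
  proof -
    have "mat 1 $ p $ q = matP $ p $ q + (Q_minus $ p $ q :: scal2)"
      by (simp flip: matP_plus_Q_minus)
    then show ?thesis
      using assms by (simp add: R_sp2_def R_circ_t_minus_def mat_mult_entry) (simp add: field_simps)
  qed
  then show ?thesis unfolding eq by (simp only: vec_eq_iff) simp
qed

lemma diag_mult_entry:
  fixes d :: "_ \<Rightarrow> 'a::semiring_1"
  assumes "\<And>p q. D $ p $ q = (if p = q then d p else 0)"
  shows "(D ** M) $ p $ q = d p * M $ p $ q" "(M ** D) $ p $ q = M $ p $ q * d q"
  by (simp_all add: matrix_matrix_mult_def assms if_distrib[of "\<lambda>x. x * _"] if_distrib[of "\<lambda>x. _ * x"]
      cong: if_cong)

lemma all_idx: "(\<forall>i. P i) \<longleftrightarrow> P Neg \<and> P Pos"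
  by (metis idx.exhaust)

lemma matK_entry: "matK $ i $ j = (if i = j then sign i else 0)"
  by (cases i; cases j) (simp_all add: matK_def matE_def sign_def)

lemma matK_square: "matK ** matK = mat 1"
  by (auto simp: vec_eq_iff diag_mult_entry[OF matK_entry] matK_entry mat_def sign_def split: idx.splits)

lemma kron_matK_entry:
  "(const_mat matK \<otimes>\<^sub>k mat 1) $ p $ q = (if p = q then sign (fst p) else 0)"
  "(mat 1 \<otimes>\<^sub>k const_mat matK) $ p $ q = (if p = q then sign (snd p) else 0)"
proof -
  have "const2 (sign i) = (sign i :: scal2)" for i
    by (cases i) (simp_all add: sign_def unital_hom_simps[OF unital_hom_const2])
  then show "(const_mat matK \<otimes>\<^sub>k mat 1) $ p $ q = (if p = q then sign (fst p) else 0)"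
    "(mat 1 \<otimes>\<^sub>k const_mat matK) $ p $ q = (if p = q then sign (snd p) else 0)"
    by (auto simp: kron_def const_mat_def matK_entry mat_def prod_eq_iff
        unital_hom_zero[OF unital_hom_const2])
qed

text \<open>Conjugation by K in one factor multiplies the entry of Q^- at (i,k), (j,l) by sign i
  sign j or by sign k sign l. These agree on the support k = -i, l = -j, and they cancel the signs
  of Q^-.\<close>

lemma matK_conjugates_R_circ_t:
  "(const_mat matK \<otimes>\<^sub>k mat 1) ** R_circ_t_minus y = R_circ_t_plus y ** (const_mat matK \<otimes>\<^sub>k mat 1)"
  "(mat 1 \<otimes>\<^sub>k const_mat matK) ** R_circ_t_minus y = R_circ_t_plus y ** (mat 1 \<otimes>\<^sub>k const_mat matK)"
proof -
  have "((const_mat matK \<otimes>\<^sub>k mat 1) ** R_circ_t_minus y) $ (i, k) $ (j, l) =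
      (R_circ_t_plus y ** (const_mat matK \<otimes>\<^sub>k mat 1)) $ (i, k) $ (j, l)"
    "((mat 1 \<otimes>\<^sub>k const_mat matK) ** R_circ_t_minus y) $ (i, k) $ (j, l) =
      (R_circ_t_plus y ** (mat 1 \<otimes>\<^sub>k const_mat matK)) $ (i, k) $ (j, l)" for i j k l
    unfolding diag_mult_entry[OF kron_matK_entry(1)] diag_mult_entry[OF kron_matK_entry(2)]
      R_circ_t_minus_def R_circ_t_plus_def
    by (cases i; cases j; cases k; cases l;
        simp add: mat_def Q_plus_entry Q_minus_entry sign_def uminus_idx_def)+
  then show
    "(const_mat matK \<otimes>\<^sub>k mat 1) ** R_circ_t_minus y = R_circ_t_plus y ** (const_mat matK \<otimes>\<^sub>k mat 1)"
    "(mat 1 \<otimes>\<^sub>k const_mat matK) ** R_circ_t_minus y = R_circ_t_plus y ** (mat 1 \<otimes>\<^sub>k const_mat matK)"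
    by (simp_all add: vec_eq_iff)
qed

text \<open>K \<otimes> K is unchanged by exchanging the tensor factors, so it commutes with
  P.\<close>

lemma matK_commutes_R_circ:
  "R_circ y ** ((const_mat matK \<otimes>\<^sub>k mat 1) ** (mat 1 \<otimes>\<^sub>k const_mat matK)) =
    (const_mat matK \<otimes>\<^sub>k mat 1) ** (mat 1 \<otimes>\<^sub>k const_mat matK) ** R_circ y"
proof -
  have KK: "((const_mat matK \<otimes>\<^sub>k mat 1) ** (mat 1 \<otimes>\<^sub>k const_mat matK)) $ p $ q =
      (if p = q then sign (fst p) * sign (snd p) else 0)" for p q
    by (simp add: diag_mult_entry[OF kron_matK_entry(1)] kron_matK_entry(2))
  have "(R_circ y ** ((const_mat matK \<otimes>\<^sub>k mat 1) ** (mat 1 \<otimes>\<^sub>k const_mat matK))) $ (i, k) $ (j, l) =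
      ((const_mat matK \<otimes>\<^sub>k mat 1) ** (mat 1 \<otimes>\<^sub>k const_mat matK) ** R_circ y) $ (i, k) $ (j, l)"
    for i j k l
    unfolding diag_mult_entry[OF KK] R_circ_def
    by (cases i; cases j; cases k; cases l; simp add: mat_def matP_entry sign_def)
  then show ?thesis by (simp add: vec_eq_iff)
qed

lemma const_mat_mat: "const_mat (mat c) = mat (const2 c)"
  unfolding const_mat_def by (rule map_matrix_mat[OF unital_hom_const2])

lemma kron_mat: "mat c \<otimes>\<^sub>k mat 1 = mat c" "mat 1 \<otimes>\<^sub>k mat c = mat c"
  by (auto simp: vec_eq_iff kron_def mat_def prod_eq_iff)

lemma mat_commute: "mat c ** M = M ** mat c" for c :: "'a::comm_semiring_1"
  by (simp add: vec_eq_iff mat_mult_entry mult.commute)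

section \<open>Nonvanishing denominators and affine changes of variable\<close>

lemma var_neq: "var_u + var_v \<noteq> 0" "var_u + var_v - 1 \<noteq> 0" "var_u + var_v - 2 \<noteq> 0"
  "var_u - var_v \<noteq> 0" "var_u - var_v - 1 \<noteq> 0" "var_u - var_v - 2 \<noteq> 0"
proof -
  \<comment> \<open>The outer index -1 reads off the coefficient of u, to which neither v nor c
    contributes.\<close>
  have "fls_nth (var_u + s * var_v - fls_const c) (-1) = 1" if "s = 1 \<or> s = - 1" for s c
    using that by (auto simp: var_u_def var_v_def)
  then have "var_u + s * var_v - fls_const c \<noteq> 0" if "s = 1 \<or> s = - 1" for s c
    using that by (metis fls_zero_nth zero_neq_one)
  from this[of 1 0] this[of 1 1] this[of 1 2] this[of "-1" 0] this[of "-1" 1] this[of "-1" 2]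
  show "var_u + var_v \<noteq> 0" "var_u + var_v - 1 \<noteq> 0" "var_u + var_v - 2 \<noteq> 0"
    "var_u - var_v \<noteq> 0" "var_u - var_v - 1 \<noteq> 0" "var_u - var_v - 2 \<noteq> 0"
    by (auto simp: fls_const_numeral)
qed

lemma unital_hom_half:
  fixes f :: "'a::field_char_0 \<Rightarrow> 'b::field_char_0"
  assumes "unital_hom f"
  shows "f (x / 2) = f x / 2"
proof -
  have "f (x / 2) + f (x / 2) = f x"
    by (simp flip: unital_hom_add[OF assms])
  then show ?thesis by (simp add: field_simps)
qed

lemma unital_hom_fls_const: "unital_hom (fls_const :: 'a::ring_1 \<Rightarrow> _)"
  by (rule unital_homI) (simp_all add: fls_plus_const)

lemma
  fixes w h :: "complex fls"
  assumes w: "w = (fls_X_inv - fls_const c) / 2" and h: "h = inverse w"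
  shows subdegree_inverse_affine: "fls_subdegree h = 1"
    and double_subst_affine_u:
      "double_subst h (embed_scal2 var_u) = embed_scal2 ((var_u - const2 c) / 2)"
    and double_subst_affine_v:
      "double_subst h (embed_scal2 var_v) = embed_scal2 ((var_v - const2 c) / 2)"
proof -
  have "fls_nth (fls_X_inv - fls_const c) (-1) \<noteq> 0" by simp
  then have "fls_subdegree (fls_X_inv - fls_const c) = -1"
    by (intro fls_subdegree_eqI) auto
  moreover have "fls_subdegree (2 :: complex fls) = 0" by simp
  ultimately have "fls_subdegree w = -1"
    unfolding w by (subst fls_divide_subdegree) auto
  then show h1: "fls_subdegree h = 1"
    by (simp add: h)
  have "map_fls fls_const fls_X_inv = var_u" "map_fls fls_const (fls_const c) = const2 c"
    by (rule fls_eqI; simp add: map_fls_nth var_u_def const2_def)+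
  then have "map_fls fls_const w = (var_u - const2 c) / 2"
    unfolding w unital_hom_half[OF unital_hom_map_fls[OF unital_hom_fls_const]]
      unital_hom_diff[OF unital_hom_map_fls[OF unital_hom_fls_const]] by simp
  then show "double_subst h (embed_scal2 var_u) = embed_scal2 ((var_u - const2 c) / 2)"
    using double_subst_var_u[OF h1] by (simp only: h inverse_inverse_eq)
  have "fls_const w = (var_v - const2 c) / 2"
    unfolding w unital_hom_half[OF unital_hom_fls_const] unital_hom_diff[OF unital_hom_fls_const]
    by (simp add: var_v_def const2_def)
  then show "double_subst h (embed_scal2 var_v) = embed_scal2 ((var_v - const2 c) / 2)"
    using double_subst_var_v[OF h1] by (simp only: h inverse_inverse_eq)
qed

lemma gen_matrix_at_eq:
  "gen_matrix_at w = subst_matrix (mat 1) (inverse w)"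
  "- gen_matrix_at w = subst_matrix (mat (- 1)) (inverse w)"
  "gen_matrix_at w ** matK = subst_matrix matK (inverse w)"
proof -
  have fps_const_hom: "unital_hom (\<lambda>c. fps_const (scalar c))"
    by (rule unital_homI) (simp_all add: unital_hom_simps[OF unital_hom_scalar])
  have gen: "gen_matrix_at w = map_matrix (fps_subst scalar (inverse w)) gen_matrix"
    by (simp add: gen_matrix_at_def vec_eq_iff fps_subst_def)
  then show "gen_matrix_at w = subst_matrix (mat 1) (inverse w)"
    by (simp add: subst_matrix_def map_matrix_mat1[OF fps_const_hom])
  show "- gen_matrix_at w = subst_matrix (mat (- 1)) (inverse w)"
    by (simp add: subst_matrix_def map_matrix_mat[OF fps_const_hom] gen vec_eq_iff mat_mult_entry
        unital_hom_simps[OF fps_const_hom])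
  have "matK = map_matrix (\<lambda>c. fps_const (scalar c)) matK"
    by (auto simp: vec_eq_iff matK_entry sign_def unital_hom_simps[OF fps_const_hom] split: idx.split)
  then show "gen_matrix_at w ** matK = subst_matrix matK (inverse w)"
    by (metis gen subst_matrix_def)
qed

theorem proposition4p1:
  fixes u :: "complex fls"
  defines "u \<equiv> fls_X_inv"
  shows "defines_algebra_iso rel_X_sp2_sp2 (rel_B2 0) (gen_matrix_at (u / 2))
    \<and> defines_algebra_iso rel_X_sp2_gl1 (rel_B2 1) (- gen_matrix_at (u / 2))
    \<and> defines_algebra_iso rel_X_sp2_sp2 rel_Y2_minus (gen_matrix_at (u / 2 - 1 / 2))
    \<and> defines_algebra_iso rel_X_sp2_gl1 rel_Y2_plus (gen_matrix_at (u / 2 - 1 / 2) ** matK)"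
proof -
  let ?m = "var_u - var_v" and ?p = "var_u + var_v"
  \<comment> \<open>c = 0 serves the targets B(2,q), and c = 1 the targets Y^+(2) and
    Y^-(2).\<close>
  have subst: "fls_subdegree h = 1"
    "map_matrix (double_subst h) (scal2_matrix (R_circ ?m)) = scal2_matrix (R_circ (?m / 2))"
    "c = 0 \<Longrightarrow> map_matrix (double_subst h) (scal2_matrix (R_circ ?p)) = scal2_matrix (R_circ (?p / 2))"
    "c = 1 \<Longrightarrow> map_matrix (double_subst h) (scal2_matrix (R_circ_t_minus (- var_u - var_v))) =
      scal2_matrix (R_circ_t_minus (1 - ?p / 2))"
    "c = 1 \<Longrightarrow> map_matrix (double_subst h) (scal2_matrix (R_circ_t_plus (- var_u - var_v))) =
      scal2_matrix (R_circ_t_plus (1 - ?p / 2))"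
    if h: "h = inverse ((u - fls_const c) / 2)" for h c
  proof -
    show h1: "fls_subdegree h = 1"
      by (rule subdegree_inverse_affine[OF refl h[unfolded u_def]])
    note hom = unital_hom_compose[OF unital_hom_double_subst[OF h1] unital_hom_embed_scal2]
    note affine = double_subst_affine_u[OF refl h[unfolded u_def]] double_subst_affine_v[OF refl h[unfolded u_def]]
    have m: "double_subst h (embed_scal2 ?m) = embed_scal2 (?m / 2)"
    proof -
      have "double_subst h (embed_scal2 ?m) =
          embed_scal2 ((var_u - const2 c) / 2 - (var_v - const2 c) / 2)"
        unfolding unital_hom_diff[OF hom] affine unital_hom_diff[OF unital_hom_embed_scal2, symmetric] ..
      also have "(var_u - const2 c) / 2 - (var_v - const2 c) / 2 = ?m / 2"
        by (simp add: field_simps)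
      finally show ?thesis .
    qed
    show "map_matrix (double_subst h) (scal2_matrix (R_circ ?m)) = scal2_matrix (R_circ (?m / 2))"
      using var_neq by (intro double_subst_R(1)[OF h1 m]) auto
    have p: "double_subst h (embed_scal2 ?p) = embed_scal2 (?p / 2 - const2 c)"
    proof -
      have "double_subst h (embed_scal2 ?p) =
          embed_scal2 ((var_u - const2 c) / 2 + (var_v - const2 c) / 2)"
        unfolding unital_hom_add[OF hom] affine unital_hom_add[OF unital_hom_embed_scal2, symmetric] ..
      also have "(var_u - const2 c) / 2 + (var_v - const2 c) / 2 = ?p / 2 - const2 c"
        by (simp add: field_simps)
      finally show ?thesis .
    qed
    show "map_matrix (double_subst h) (scal2_matrix (R_circ ?p)) = scal2_matrix (R_circ (?p / 2))"
      if "c = 0"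
      using p var_neq that
      by (intro double_subst_R(1)[OF h1]) (auto simp: unital_hom_zero[OF unital_hom_const2])
    \<comment> \<open>The new argument 1 - (u + v)/2 is the one that
      \<open>R_sp2_eq_R_circ_t_minus\<close> produces from R(u + v).\<close>
    have neg: "double_subst h (embed_scal2 (- var_u - var_v)) = embed_scal2 (1 - ?p / 2)" if "c = 1"
    proof -
      have "- var_u - var_v = - ?p" "1 - ?p / 2 = - (?p / 2 - const2 c)"
        using that by (simp_all add: unital_hom_one[OF unital_hom_const2])
      then show ?thesis
        using unital_hom_uminus[OF hom, of ?p]
          unital_hom_uminus[OF unital_hom_embed_scal2, of "?p / 2 - const2 c"]
        by (simp only: p)
    qed
    have "1 - ?p / 2 = - (?p - 2) / 2" by (simp add: field_simps)
    then have ne: "- var_u - var_v \<noteq> 0" "1 - ?p / 2 \<noteq> 0"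
      using var_neq(1,3) by (auto simp: add_eq_0_iff neg_eq_iff_add_eq_0)
    show "map_matrix (double_subst h) (scal2_matrix (R_circ_t_minus (- var_u - var_v))) =
        scal2_matrix (R_circ_t_minus (1 - ?p / 2))" if "c = 1"
      by (rule double_subst_R(3)[OF h1 neg[OF that] ne])
    show "map_matrix (double_subst h) (scal2_matrix (R_circ_t_plus (- var_u - var_v))) =
        scal2_matrix (R_circ_t_plus (1 - ?p / 2))" if "c = 1"
      by (rule double_subst_R(2)[OF h1 neg[OF that] ne])
  qed
  have w: "u / 2 = (u - fls_const 0) / 2" "u / 2 - 1 / 2 = (u - fls_const 1) / 2"
    by (simp_all add: diff_divide_distrib)
  note s0 = subst[OF arg_cong[of _ _ inverse, OF w(1)]]
  note s1 = subst[OF arg_cong[of _ _ inverse, OF w(2)]]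
  note R_m = R_sp2_eq_R_circ[OF var_neq(4,6)]
  note R_p = R_sp2_eq_R_circ[OF var_neq(1,3)] and R_p' = R_sp2_eq_R_circ_t_minus[OF var_neq(1,3)]
  have ne: "(?m - 1) / (?m - 2) \<noteq> 0" "(?p - 1) / (?p - 2) \<noteq> 0" "(?p - 1) / ?p \<noteq> 0"
    using var_neq by simp_all
  \<comment> \<open>For q = 1 the target constant term is -K; the sign in \<phi>_1, that is E = -1,
    turns it into K.\<close>
  have const_term: "matE Neg Neg + map_matrix (\<lambda>x. (- 1) ^ 0 * x) (matE Pos Pos) = (mat 1 :: complex mat2)"
    "matE Neg Neg + map_matrix (\<lambda>x. (- 1) ^ 1 * x) (matE Pos Pos) = (- matK :: complex mat2)"
    "matK = (- matK :: complex mat2) ** mat (- 1)"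
    by (simp_all add: vec_eq_iff mat_mult_entry)
      (simp_all add: all_idx matK_entry matE_def mat_def sign_def)
  have central: "M ** mat c = mat c ** M" for M :: "scal2 mat4" and c by (rule mat_commute[symmetric])
  have "defines_algebra_iso rel_X_sp2_sp2 (rel_B2 0) (gen_matrix_at (u / 2))"
    unfolding gen_matrix_at_eq(1) rel_X_sp2_sp2_def rel_B2_def const_term(1)
    by (rule defines_algebra_iso_relators[OF s0(1) _ _ s0(2) s0(3)[OF refl] R_m ne(1) _ _ _ ne(2)])
      (simp_all add: const_mat_mat kron_mat unital_hom_one[OF unital_hom_const2] R_p)
  moreover have "defines_algebra_iso rel_X_sp2_gl1 (rel_B2 1) (- gen_matrix_at (u / 2))"
    unfolding gen_matrix_at_eq(2) rel_X_sp2_gl1_def rel_B2_def const_term(2)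
  proof (rule defines_algebra_iso_relators[OF s0(1) _ const_term(3) s0(2) s0(3)[OF refl] R_m ne(1) _ _ _ ne(2)];
      (simp only: const_mat_mat kron_mat R_p mat_mult_mat)?)
  qed (simp, rule mat_commute[symmetric], rule mat_commute, rule mat_commute)
  moreover have "defines_algebra_iso rel_X_sp2_sp2 rel_Y2_minus (gen_matrix_at (u / 2 - 1 / 2))"
    unfolding gen_matrix_at_eq(1) rel_X_sp2_sp2_def rel_Y2_minus_def
    by (rule defines_algebra_iso_relators[OF s1(1) _ _ s1(2) s1(4)[OF refl] R_m ne(1) _ _ _ ne(3)])
      (simp_all add: const_mat_mat kron_mat unital_hom_one[OF unital_hom_const2] R_p')
  \<comment> \<open>The source relation involves Q^- and the target Q^+. The factor K accounts both
    for this exchange and for the constant term.\<close>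
  moreover have "defines_algebra_iso rel_X_sp2_gl1 rel_Y2_plus (gen_matrix_at (u / 2 - 1 / 2) ** matK)"
    unfolding gen_matrix_at_eq(3) rel_X_sp2_gl1_def rel_Y2_plus_def
  proof (rule defines_algebra_iso_relators[OF s1(1) matK_square _ s1(2) s1(5)[OF refl] R_m ne(1)
        matK_commutes_R_circ _ _ ne(3)])
    \<comment> \<open>The scalar factor is pulled out first, so that K stands directly before
      \<open>R_circ_t_minus\<close> and the conjugation rule applies.\<close>
    have left: "N ** R_sp2 ?p = mat ((?p - 1) / ?p) ** (N ** R_circ_t_minus (1 - ?p / 2))" for N :: "scal2 mat4"
    proof -
      have "N ** R_sp2 ?p = (N ** mat ((?p - 1) / ?p)) ** R_circ_t_minus (1 - ?p / 2)"
        by (simp only: R_p' matrix_mul_assoc)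
      then show ?thesis by (simp only: central[of N] matrix_mul_assoc)
    qed
    show "(const_mat matK \<otimes>\<^sub>k mat 1) ** R_sp2 ?p =
        mat ((?p - 1) / ?p) ** R_circ_t_plus (1 - ?p / 2) ** (const_mat matK \<otimes>\<^sub>k mat 1)"
      "(mat 1 \<otimes>\<^sub>k const_mat matK) ** R_sp2 ?p =
        mat ((?p - 1) / ?p) ** R_circ_t_plus (1 - ?p / 2) ** (mat 1 \<otimes>\<^sub>k const_mat matK)"
      unfolding left matK_conjugates_R_circ_t by (simp_all only: matrix_mul_assoc)
  qed simp
  ultimately show ?thesis by blast
qed

end
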